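(* The assignment ${}_\bullet(-):{}^\bullet\mathcal C^\infty\to\mathbf{Diff}$ defined by $$X\ \longmapsto\ {}_\bullet X=\operatorname{colim}_{{}^\bullet U\in\mathcal F'/X}U$$ (colimit taken in $\mathbf{Diff}$) is a functor.
   Context: FERMAT EXTENSIONS. For $U\subseteq\mathbb R^n$ open, a little-oh polynomial on $U$ is a function $x:[0,\epsilon)\to U$ (some $\epsilon>0$, not fixed) such that for some $r\in U$, $k\in\mathbb N$, $\alpha_i\in\mathbb R^n$, $a_i>0$ one has $x(0)=r$ and $\|x(t)-r-\sum_{i=1}^k\alpha_it^{a_i}\|=o(t)$ as $t\to0^+$. Two such $x,y$ are equivalent if $x(0)=y(0)$ and $x(t)-y(t)=o(t)$; ${}^\bullet U$ is the set of equivalence classes, and ${}^\circ x:=x(0)\in U$ is the standard part. Identify ${}^\bullet U=\{x\in{}^\bullet\mathbb R^n: {}^\circ x\in U\}$ and ${}^\bullet(U\times V)={}^\bullet U\times{}^\bullet V$. The map $i_U:U\to{}^\bullet U$ sends $u$ to the class of the constant function $u$, and $ev_0:{}^\bullet U\to U$ is $x\mapsto{}^\circ x$. A smooth map $f:U\to V$ of open subsets of Euclidean spaces has the Fermat extension ${}^\bullet f:{}^\bullet U\to{}^\bullet V$, $[x]\mapsto[f\circ x]$. The Fermat topology on ${}^\bullet\mathbb R^n$ has as open sets exactly the ${}^\bullet U$ with $U\subseteq\mathbb R^n$ open; subsets carry the subspace topology. For $A\subseteq{}^\bullet\mathbb R^n$, $B\subseteq{}^\bullet\mathbb R^m$, a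 function $f:A\to B$ is quasi-standard smooth if for every $a\in A$ there are an open neighborhood $U$ of ${}^\circ a$ in $\mathbb R^n$, an open subset $P$ of a Euclidean space, a smooth map $\alpha:P\times U\to\mathbb R^m$ and a point $p\in{}^\bullet P$ with $f(x)={}^\bullet\alpha(p,x)$ for all $x\in A\cap{}^\bullet U$. SITES AND SPACES. $\mathcal S$ is the site of all open subsets of all $\mathbb R^n$, $n\in\mathbb N$, with smooth maps and usual open coverings. $\mathcal F$ is the site of all subsets of all ${}^\bullet\mathbb R^n$, with quasi-standard smooth maps and coverings by Fermat-open subsets. $\mathcal F'$ is the full subcategory of $\mathcal F$ on the objects ${}^\bullet U$ with $U$ an open subset of some $\mathbb R^n$. For $\mathcal A=\mathcal S$ or $\mathcal F$, a concrete sheaf $X$ over $\mathcal A$ is a set $|X|$ with, for each object $A$ of $\mathcal A$, a collection of functions $A\to|X|$ called sections, such that constant functions are sections, sections are stable under precomposition with morphisms of $\mathcal A$, and a function that is a section on each member of a cover of $A$ is a section. Morphisms are functions sending sections to sections by composition. Concrete sheaves over $\mathcal S$ are the diffeological spaces (sections: plots; morphisms: smooth maps; category $\mathbf{Diff}$); those over $\mathcal F$ are the Fermat spaces (sections: Fermat plots; morphisms: Fermat maps; category ${}^\bullet\mathcal C^\infty$). Each object of $\mathcal A$ is a concrete sheaf whose sections are the morphisms of $\mathcal A$ into it. DELETING INFINITESIMALS. For a Fermat space $X$, $\mathcal F'/X$ has as objects the Fermat plots $p:{}^\bullet U\to X$ with ${}^\bullet U\in\mathcal F'$, and as morphisms from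 $p:{}^\bullet U\to X$ to $q:{}^\bullet V\to X$ the quasi-standard smooth maps $f:{}^\bullet U\to{}^\bullet V$ with $q\circ f=p$. The diagram for the colimit sends $p:{}^\bullet U\to X$ to $U\in\mathbf{Diff}$ and $f:{}^\bullet U\to{}^\bullet V$ to the map ${}_\bullet f:=ev_0\circ f\circ i_U:U\to V$, $u\mapsto{}^\circ(f(u))$ (this gives a functor $\mathcal F'\to\mathcal S$). A Fermat map $g:X\to Y$ acts by the functor $\mathcal F'/X\to\mathcal F'/Y$, $p\mapsto g\circ p$. *)

theory Defs
  imports "HOL-Analysis.Analysis" "HOL-Library.Landau_Symbols" "HOL-Library.FuncSet"
begin

section \<open>Euclidean spaces of varying dimension and smooth maps\<close>

text \<open>
  The dimension varies inside the sites below, so the space of dimension n is the library's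
  \<^const>\<open>Euclidean_space\<close> n: sequences of reals vanishing from index n on.
\<close>

type_synonym rvec = "nat \<Rightarrow> real"

abbreviation eucl :: "nat \<Rightarrow> rvec set" where
  "eucl n \<equiv> topspace (Euclidean_space n)"

definition vnorm :: "nat \<Rightarrow> rvec \<Rightarrow> real" where
  "vnorm n v = L2_set v {..<n}"

definition vappend :: "nat \<Rightarrow> rvec \<Rightarrow> rvec \<Rightarrow> rvec" where
  "vappend k u v = (\<lambda>i. if i < k then u i else v (i - k))"

definition vprod :: "nat \<Rightarrow> rvec set \<Rightarrow> rvec set \<Rightarrow> rvec set" where
  "vprod k P U = {vappend k u v | u v. u \<in> P \<and> v \<in> U}"

text \<open>
  \<open>Cdiff n U k f\<close>: on the open subset U of the space of dimension n, all iterated partial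
  derivatives of f of order at most k exist and are continuous.
\<close>

primrec Cdiff :: "nat \<Rightarrow> rvec set \<Rightarrow> nat \<Rightarrow> (rvec \<Rightarrow> real) \<Rightarrow> bool" where
  "Cdiff n U 0 f \<longleftrightarrow> continuous_map (subtopology (Euclidean_space n) U) euclideanreal f"
| "Cdiff n U (Suc k) f \<longleftrightarrow>
     continuous_map (subtopology (Euclidean_space n) U) euclideanreal f \<and>
     (\<exists>D. \<forall>i<n.
        (\<forall>x\<in>U. ((\<lambda>s. f (x(i := s))) has_real_derivative D i x) (at (x i))) \<and>
        Cdiff n U k (D i))"

definition smooth_on :: "nat \<Rightarrow> rvec set \<Rightarrow> nat \<Rightarrow> (rvec \<Rightarrow> rvec) \<Rightarrow> bool" where
  "smooth_on n U m f \<longleftrightarrow> (\<forall>j<m. \<forall>k. Cdiff n U k (\<lambda>x. f x j))"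


section \<open>Fermat extensions\<close>

text \<open>
  Partial functions on an interval \<open>[0,\<epsilon>)\<close> are represented by total functions. Values
  outside of the interval do not matter: the equivalence relation only sees the value at 0 and the
  germ at 0 from the right.
\<close>

definition little_oh_poly :: "nat \<Rightarrow> (real \<Rightarrow> rvec) \<Rightarrow> bool" where
  "little_oh_poly n x \<longleftrightarrow>
     (\<exists>\<epsilon>>0. \<forall>t\<in>{0..<\<epsilon>}. x t \<in> eucl n) \<and>
     (\<exists>r\<in>eucl n. \<exists>k::nat. \<exists>\<alpha>::nat \<Rightarrow> rvec. \<exists>a::nat \<Rightarrow> real.
        (\<forall>i\<in>{1..k}. \<alpha> i \<in> eucl n \<and> a i > 0) \<and>
        x 0 = r \<and>
        (\<lambda>t. vnorm n (\<lambda>j. x t j - r j - (\<Sum>i=1..k. \<alpha> i j * t powr a i))) \<in> o[at_right 0](\<lambda>t. t))"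

definition fermat_rel :: "nat \<Rightarrow> ((real \<Rightarrow> rvec) \<times> (real \<Rightarrow> rvec)) set" where
  "fermat_rel n = {(x, y). little_oh_poly n x \<and> little_oh_poly n y \<and> x 0 = y 0 \<and>
     (\<lambda>t. vnorm n (\<lambda>j. x t j - y t j)) \<in> o[at_right 0](\<lambda>t. t)}"

type_synonym fpoint = "(real \<Rightarrow> rvec) set"

definition fermat_eucl :: "nat \<Rightarrow> fpoint set" where
  "fermat_eucl n = {x. little_oh_poly n x} // fermat_rel n"

definition std_part :: "fpoint \<Rightarrow> rvec" where
  "std_part c = the_elem ((\<lambda>x. x 0) ` c)"

text \<open>
  For open U, little-oh polynomials on U are identified with little-oh polynomials starting
  in U (they are continuous at 0).
\<close>

definition fermat_ext_set :: "nat \<Rightarrow> rvec set \<Rightarrow> fpoint set" where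
  "fermat_ext_set n U = {c \<in> fermat_eucl n. std_part c \<in> U}"

definition const_point :: "nat \<Rightarrow> rvec \<Rightarrow> fpoint" where
  "const_point n u = fermat_rel n `` {\<lambda>t. u}"

definition fermat_ext_map :: "nat \<Rightarrow> (rvec \<Rightarrow> rvec) \<Rightarrow> fpoint \<Rightarrow> fpoint" where
  "fermat_ext_map m f c = (\<Union>x\<in>c. fermat_rel m `` {f \<circ> x})"

text \<open>The identification of a pair of Fermat points with a Fermat point of the product space.\<close>

definition fermat_pair :: "nat \<Rightarrow> nat \<Rightarrow> fpoint \<Rightarrow> fpoint \<Rightarrow> fpoint" where
  "fermat_pair k n p c =
     (\<Union>x\<in>p. \<Union>y\<in>c. fermat_rel (k + n) `` {\<lambda>t. vappend k (x t) (y t)})"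

definition fermat_topology :: "nat \<Rightarrow> fpoint topology" where
  "fermat_topology n =
     topology (\<lambda>W. \<exists>U. openin (Euclidean_space n) U \<and> W = fermat_ext_set n U)"

definition quasi_standard_smooth ::
    "nat \<Rightarrow> fpoint set \<Rightarrow> nat \<Rightarrow> (fpoint \<Rightarrow> fpoint) \<Rightarrow> bool" where
  "quasi_standard_smooth n A m f \<longleftrightarrow>
     (\<forall>a\<in>A. \<exists>U k P \<alpha> p.
        openin (Euclidean_space n) U \<and> std_part a \<in> U \<and>
        openin (Euclidean_space k) P \<and>
        \<alpha> \<in> vprod k P U \<rightarrow> eucl m \<and> smooth_on (k + n) (vprod k P U) m \<alpha> \<and>
        p \<in> fermat_ext_set k P \<and>
        (\<forall>c \<in> A \<inter> fermat_ext_set n U. f c = fermat_ext_map m \<alpha> (fermat_pair k n p c)))"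


section \<open>Sites and concrete sheaves\<close>

text \<open>
  An object is a set of points tagged with the dimension of the ambient space. Functions with
  domain A are represented by total functions that are undefined outside of A (\<open>\<rightarrow>\<^sub>E\<close>), so that
  equality of functions is equality on A.
\<close>

type_synonym 'p sobj = "nat \<times> 'p set"

record 'p site =
  objects :: "'p sobj set"
  mors :: "'p sobj \<Rightarrow> 'p sobj \<Rightarrow> ('p \<Rightarrow> 'p) set"
  covers :: "'p sobj \<Rightarrow> 'p sobj set set"

definition open_covers :: "(nat \<Rightarrow> 'p topology) \<Rightarrow> 'p sobj \<Rightarrow> 'p sobj set set" where
  "open_covers \<tau> A =
     {\<C>. (\<forall>B\<in>\<C>. fst B = fst A \<and> openin (subtopology (\<tau> (fst A)) (snd A)) (snd B)) \<and>
          (\<Union>B\<in>\<C>. snd B) = snd A}"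

definition smooth_site :: "rvec site" where
  "smooth_site = \<lparr>
     objects = {(n, U). openin (Euclidean_space n) U},
     mors = (\<lambda>(n, U) (m, V). {f \<in> U \<rightarrow>\<^sub>E V. smooth_on n U m f}),
     covers = open_covers Euclidean_space \<rparr>"

definition fermat_site :: "fpoint site" where
  "fermat_site = \<lparr>
     objects = {(n, A). A \<subseteq> fermat_eucl n},
     mors = (\<lambda>(n, A) (m, B). {f \<in> A \<rightarrow>\<^sub>E B. quasi_standard_smooth n A m f}),
     covers = open_covers fermat_topology \<rparr>"

record ('p, 'a) cspace =
  points :: "'a set"
  sections :: "'p sobj \<Rightarrow> ('p \<Rightarrow> 'a) set"

definition concrete_sheaf :: "'p site \<Rightarrow> ('p, 'a) cspace \<Rightarrow> bool" where
  "concrete_sheaf S X \<longleftrightarrow>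
     (\<forall>A\<in>objects S. sections X A \<subseteq> snd A \<rightarrow>\<^sub>E points X) \<and>
     (\<forall>A\<in>objects S. \<forall>c\<in>points X. (\<lambda>a\<in>snd A. c) \<in> sections X A) \<and>
     (\<forall>A\<in>objects S. \<forall>B\<in>objects S. \<forall>f\<in>mors S A B. \<forall>p\<in>sections X B.
        compose (snd A) p f \<in> sections X A) \<and>
     (\<forall>A\<in>objects S. \<forall>\<C>\<in>covers S A. \<forall>p \<in> snd A \<rightarrow>\<^sub>E points X.
        (\<forall>B\<in>\<C>. restrict p (snd B) \<in> sections X B) \<longrightarrow> p \<in> sections X A)"

definition sheaf_maps :: "'p site \<Rightarrow> ('p, 'a) cspace \<Rightarrow> ('p, 'b) cspace \<Rightarrow> ('a \<Rightarrow> 'b) set" where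
  "sheaf_maps S X Y =
     {g \<in> points X \<rightarrow>\<^sub>E points Y.
        \<forall>A\<in>objects S. \<forall>p\<in>sections X A. compose (snd A) g p \<in> sections Y A}"

definition representable :: "'p site \<Rightarrow> 'p sobj \<Rightarrow> ('p, 'p) cspace" where
  "representable S A = \<lparr> points = snd A, sections = (\<lambda>B. mors S B A) \<rparr>"

type_synonym 'a diff_space = "(rvec, 'a) cspace"
type_synonym 'a fermat_space = "(fpoint, 'a) cspace"

abbreviation is_diff_space :: "'a diff_space \<Rightarrow> bool" where
  "is_diff_space \<equiv> concrete_sheaf smooth_site"

abbreviation is_fermat_space :: "'a fermat_space \<Rightarrow> bool" where
  "is_fermat_space \<equiv> concrete_sheaf fermat_site"

abbreviation smooth_maps :: "'a diff_space \<Rightarrow> 'b diff_space \<Rightarrow> ('a \<Rightarrow> 'b) set" where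
  "smooth_maps \<equiv> sheaf_maps smooth_site"

abbreviation fermat_maps :: "'a fermat_space \<Rightarrow> 'b fermat_space \<Rightarrow> ('a \<Rightarrow> 'b) set" where
  "fermat_maps \<equiv> sheaf_maps fermat_site"


section \<open>Functors and colimits in the category of diffeological spaces\<close>

record ('o, 'm) cat =
  Ob :: "'o set"
  Hom :: "'o \<Rightarrow> 'o \<Rightarrow> 'm set"
  Ident :: "'o \<Rightarrow> 'm"
  Comp :: "'o \<Rightarrow> 'o \<Rightarrow> 'o \<Rightarrow> 'm \<Rightarrow> 'm \<Rightarrow> 'm" \<comment> \<open>\<open>Comp i j k g f\<close> for f from i to j, g from j to k\<close>

definition is_functor ::
    "('o, 'm) cat \<Rightarrow> ('u, 'v) cat \<Rightarrow> ('o \<Rightarrow> 'u) \<Rightarrow> ('o \<Rightarrow> 'o \<Rightarrow> 'm \<Rightarrow> 'v) \<Rightarrow> bool" where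
  "is_functor C D F0 F1 \<longleftrightarrow>
     (\<forall>i\<in>Ob C. F0 i \<in> Ob D) \<and>
     (\<forall>i\<in>Ob C. \<forall>j\<in>Ob C. \<forall>f\<in>Hom C i j. F1 i j f \<in> Hom D (F0 i) (F0 j)) \<and>
     (\<forall>i\<in>Ob C. F1 i i (Ident C i) = Ident D (F0 i)) \<and>
     (\<forall>i\<in>Ob C. \<forall>j\<in>Ob C. \<forall>k\<in>Ob C. \<forall>f\<in>Hom C i j. \<forall>g\<in>Hom C j k.
        F1 i k (Comp C i j k g f) = Comp D (F0 i) (F0 j) (F0 k) (F1 j k g) (F1 i j f))"

definition diff_cat :: "('a diff_space, 'a \<Rightarrow> 'a) cat" where
  "diff_cat = \<lparr>
     Ob = {X. is_diff_space X},
     Hom = smooth_maps,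
     Ident = (\<lambda>X. \<lambda>x\<in>points X. x),
     Comp = (\<lambda>X Y Z g f. compose (points X) g f) \<rparr>"

definition is_cocone ::
    "('o, 'm) cat \<Rightarrow> ('o \<Rightarrow> 'd diff_space) \<Rightarrow> ('o \<Rightarrow> 'o \<Rightarrow> 'm \<Rightarrow> 'd \<Rightarrow> 'd) \<Rightarrow>
     'e diff_space \<Rightarrow> ('o \<Rightarrow> 'd \<Rightarrow> 'e) \<Rightarrow> bool" where
  "is_cocone J D0 D1 T h \<longleftrightarrow>
     (\<forall>i\<in>Ob J. h i \<in> smooth_maps (D0 i) T) \<and>
     (\<forall>i\<in>Ob J. \<forall>j\<in>Ob J. \<forall>f\<in>Hom J i j. compose (points (D0 i)) (h j) (D1 i j f) = h i)"

text \<open>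
  The colimit: the quotient of the disjoint union by the equivalence relation generated by the
  diagram, with the functions that locally lift to a plot of some member of the diagram as plots.
\<close>

definition colim_step ::
    "('o, 'm) cat \<Rightarrow> ('o \<Rightarrow> 'd diff_space) \<Rightarrow> ('o \<Rightarrow> 'o \<Rightarrow> 'm \<Rightarrow> 'd \<Rightarrow> 'd) \<Rightarrow>
     (('o \<times> 'd) \<times> ('o \<times> 'd)) set" where
  "colim_step J D0 D1 =
     {((i, x), (j, D1 i j f x)) | i j f x.
        i \<in> Ob J \<and> j \<in> Ob J \<and> f \<in> Hom J i j \<and> x \<in> points (D0 i)}"

definition colim_class ::
    "('o, 'm) cat \<Rightarrow> ('o \<Rightarrow> 'd diff_space) \<Rightarrow> ('o \<Rightarrow> 'o \<Rightarrow> 'm \<Rightarrow> 'd \<Rightarrow> 'd) \<Rightarrow>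
     'o \<times> 'd \<Rightarrow> ('o \<times> 'd) set" where
  "colim_class J D0 D1 z = (colim_step J D0 D1 \<union> (colim_step J D0 D1)\<inverse>)\<^sup>* `` {z}"

definition colim_leg ::
    "('o, 'm) cat \<Rightarrow> ('o \<Rightarrow> 'd diff_space) \<Rightarrow> ('o \<Rightarrow> 'o \<Rightarrow> 'm \<Rightarrow> 'd \<Rightarrow> 'd) \<Rightarrow>
     'o \<Rightarrow> 'd \<Rightarrow> ('o \<times> 'd) set" where
  "colim_leg J D0 D1 i = (\<lambda>x\<in>points (D0 i). colim_class J D0 D1 (i, x))"

definition colim ::
    "('o, 'm) cat \<Rightarrow> ('o \<Rightarrow> 'd diff_space) \<Rightarrow> ('o \<Rightarrow> 'o \<Rightarrow> 'm \<Rightarrow> 'd \<Rightarrow> 'd) \<Rightarrow>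
     ('o \<times> 'd) set diff_space" where
  "colim J D0 D1 = (let Q = colim_class J D0 D1 ` (SIGMA i:Ob J. points (D0 i)) in \<lparr>
     points = Q,
     sections = (\<lambda>(n, W). {\<phi> \<in> W \<rightarrow>\<^sub>E Q.
       \<forall>w\<in>W. \<exists>W'\<subseteq>W. openin (Euclidean_space n) W' \<and> w \<in> W' \<and>
         (\<exists>i\<in>Ob J. \<exists>\<psi>\<in>sections (D0 i) (n, W').
            restrict \<phi> W' = compose W' (colim_leg J D0 D1 i) \<psi>)}) \<rparr>)"

definition mediating_maps ::
    "('o, 'm) cat \<Rightarrow> ('o \<Rightarrow> 'd diff_space) \<Rightarrow> ('o \<Rightarrow> 'o \<Rightarrow> 'm \<Rightarrow> 'd \<Rightarrow> 'd) \<Rightarrow>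
     'c diff_space \<Rightarrow> ('o \<Rightarrow> 'd \<Rightarrow> 'c) \<Rightarrow> 'e diff_space \<Rightarrow> ('o \<Rightarrow> 'd \<Rightarrow> 'e) \<Rightarrow> ('c \<Rightarrow> 'e) set" where
  "mediating_maps J D0 D1 C c T h =
     {u \<in> smooth_maps C T. \<forall>i\<in>Ob J. compose (points (D0 i)) u (c i) = h i}"

definition colim_desc ::
    "('o, 'm) cat \<Rightarrow> ('o \<Rightarrow> 'd diff_space) \<Rightarrow> ('o \<Rightarrow> 'o \<Rightarrow> 'm \<Rightarrow> 'd \<Rightarrow> 'd) \<Rightarrow>
     'e diff_space \<Rightarrow> ('o \<Rightarrow> 'd \<Rightarrow> 'e) \<Rightarrow> ('o \<times> 'd) set \<Rightarrow> 'e" where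
  "colim_desc J D0 D1 T h =
     (THE u. u \<in> mediating_maps J D0 D1 (colim J D0 D1) (colim_leg J D0 D1) T h)"


section \<open>Deleting infinitesimals\<close>

definition ext_obj :: "rvec sobj \<Rightarrow> fpoint sobj" where
  "ext_obj A = (fst A, fermat_ext_set (fst A) (snd A))"

type_synonym 'a fplot = "rvec sobj \<times> (fpoint \<Rightarrow> 'a)"

text \<open>
  The category of Fermat plots of X whose domain is the Fermat extension of an open set. An object
  is recorded by the open set itself (the set of standard parts of its extension) and the plot.
\<close>

definition plots_over :: "'a fermat_space \<Rightarrow> ('a fplot, fpoint \<Rightarrow> fpoint) cat" where
  "plots_over X = \<lparr>
     Ob = {(A, p). A \<in> objects smooth_site \<and> p \<in> sections X (ext_obj A)},
     Hom = (\<lambda>(A, p) (B, q). {f \<in> mors fermat_site (ext_obj A) (ext_obj B).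
              compose (snd (ext_obj A)) q f = p}),
     Ident = (\<lambda>(A, p). \<lambda>c\<in>snd (ext_obj A). c),
     Comp = (\<lambda>(A, p) j k g f. compose (snd (ext_obj A)) g f) \<rparr>"

definition base_space :: "'a fplot \<Rightarrow> rvec diff_space" where
  "base_space P = representable smooth_site (fst P)"

definition base_map :: "'a fplot \<Rightarrow> 'a fplot \<Rightarrow> (fpoint \<Rightarrow> fpoint) \<Rightarrow> rvec \<Rightarrow> rvec" where
  "base_map P P' f = (\<lambda>u\<in>snd (fst P). std_part (f (const_point (fst (fst P)) u)))"

type_synonym 'a del_point = "('a fplot \<times> rvec) set"

definition del :: "'a fermat_space \<Rightarrow> 'a del_point diff_space" where
  "del X = colim (plots_over X) base_space base_map"

definition del_leg :: "'a fermat_space \<Rightarrow> 'a fplot \<Rightarrow> rvec \<Rightarrow> 'a del_point" where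
  "del_leg X = colim_leg (plots_over X) base_space base_map"

definition push_plot :: "('a \<Rightarrow> 'b) \<Rightarrow> 'a fplot \<Rightarrow> 'b fplot" where
  "push_plot g = (\<lambda>(A, p). (A, compose (snd (ext_obj A)) g p))"

definition del_map ::
    "'a fermat_space \<Rightarrow> 'b fermat_space \<Rightarrow> ('a \<Rightarrow> 'b) \<Rightarrow> 'a del_point \<Rightarrow> 'b del_point" where
  "del_map X Y g =
     colim_desc (plots_over X) base_space base_map (del Y) (\<lambda>P. del_leg Y (push_plot g P))"

end

theory Submission
  imports Defs
begin

text \<open>
  Why the assignment is functorial. Composition with a Fermat map g from X to Y sends a plot of X
  to a plot of Y with the same domain, and leaves the morphisms between plots unchanged. The
  diagram whose colimit is \<open>del X\<close> is therefore the diagram of \<open>del Y\<close> reindexed along this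
  operation, and the legs into \<open>del Y\<close> form a cocone over it (\<open>push_plot_cocone\<close>). The induced map is
  the unique one compatible with the legs; since the identity of \<open>del X\<close> and the composite of two
  induced maps are compatible with the appropriate legs as well, uniqueness gives both functor
  laws (\<open>del_map_ident\<close>, \<open>del_map_compose\<close>).

  Two things have to be established before this formal argument applies.

  First, the diagram must take values in smooth maps and respect composition
  (\<open>base_functor\<close>). Near each point a quasi-standard smooth f has the form
  \<open>f c = \<^bold>\<alpha>(p, c)\<close> with \<open>\<^bold>\<alpha>\<close> the extension of a smooth \<open>\<alpha>\<close>. Evaluating representatives at 0 shows
  that the standard part of \<open>f c\<close> is \<open>\<alpha>(p\<^sub>0, c\<^sub>0)\<close>, where \<open>p\<^sub>0\<close> and \<open>c\<^sub>0\<close> are the standard parts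
  (\<open>std_part_locally_smooth\<close>). It depends on \<open>c\<^sub>0\<close> only, which gives compatibility with composition,
  and it does so through a slice of a smooth map, which gives smoothness.

  Second, the quotient of the disjoint union, with the locally liftable functions as plots, must
  be a diffeological space with the universal property (\<open>colim_is_diff_space\<close>,
  \<open>colim_universal\<close>). Locality of plots makes the induced map out of the quotient smooth: on a
  small enough set a plot of the quotient factors through a leg, and the sheaf condition of the
  target glues these pieces.

  Both rest on the fact that open sets with smooth maps form a site on which the representables are
  sheaves (\<open>representable_is_diff_space\<close>). As smoothness is defined by iterated partial
  derivatives of functions on sequences, closure under composition is the chain rule for functions
  with continuous partial derivatives, which is proved from the mean value inequality along
  paths parallel to the axes (\<open>linear_approximation\<close>).
\<close>

section \<open>Smooth maps in terms of partial derivatives\<close>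

(* Kept folded: Cdiff_SucI and Cdiff_SucE open the existential with a named witness. *)
declare Cdiff.simps(2) [simp del]

text \<open>
  Cubes form a neighbourhood basis: a basic open set of the product topology restricts each
  coordinate below n to an open set, which contains an interval, and the finitely many intervals have
  a least radius; all further coordinates vanish.
\<close>
lemma openin_Euclidean_box:
  assumes U: "openin (Euclidean_space n) U" and x: "x \<in> U"
  obtains d where "d > 0" "\<And>y. \<lbrakk>y \<in> eucl n; \<And>j. j < n \<Longrightarrow> \<bar>y j - x j\<bar> < d\<rbrakk> \<Longrightarrow> y \<in> U"
proof -
  obtain T where T: "openin (powertop_real UNIV) T" and UT: "U = T \<inter> eucl n"
    using U by (auto simp: Euclidean_space_def openin_subtopology)
  then obtain B where B: "\<And>i. open (B i)" "x \<in> Pi\<^sub>E UNIV B" "Pi\<^sub>E UNIV B \<subseteq> T"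
    using x unfolding openin_product_topology_alt by auto metis
  have "\<exists>e>0. \<forall>s. \<bar>s - x i\<bar> < e \<longrightarrow> s \<in> B i" for i
    using B(1)[of i] B(2) unfolding open_real by (auto simp: PiE_iff)
  then obtain e where e: "\<And>i. e i > 0" "\<And>i s. \<bar>s - x i\<bar> < e i \<Longrightarrow> s \<in> B i"
    by metis
  define d where "d = Min (insert 1 (e ` {..<n}))"
  have d: "d > 0" "\<And>i. i < n \<Longrightarrow> d \<le> e i"
    using e(1) by (auto simp: d_def)
  show ?thesis
  proof
    fix y assume y: "y \<in> eucl n" "\<And>j. j < n \<Longrightarrow> \<bar>y j - x j\<bar> < d"
    have "y i \<in> B i" for i
    proof (cases "i < n")
      case True
      then show ?thesis using y(2) d(2) e(2) by (meson less_le_trans)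
    next
      case False
      then have "y i = x i"
        using y(1) x UT by (simp add: topspace_Euclidean_space)
      then show ?thesis using e by simp
    qed
    then show "y \<in> U" using B(3) y(1) UT by (auto simp: PiE_iff)
  qed (rule d(1))
qed

lemma openin_Euclidean_subset: "openin (Euclidean_space n) U \<Longrightarrow> x \<in> U \<Longrightarrow> x \<in> eucl n"
  using openin_subset by blast

lemma eucl_update: "x \<in> eucl n \<Longrightarrow> i < n \<Longrightarrow> x(i := s) \<in> eucl n"
  by (auto simp: topspace_Euclidean_space)

lemma eventually_update_in:
  assumes "openin (Euclidean_space n) U" "x \<in> U" "i < n"
  shows "eventually (\<lambda>s. x(i := s) \<in> U) (nhds (x i))"
proof -
  obtain d where d: "d > 0" "\<And>y. \<lbrakk>y \<in> eucl n; \<And>j. j < n \<Longrightarrow> \<bar>y j - x j\<bar> < d\<rbrakk> \<Longrightarrow> y \<in> U"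
    using openin_Euclidean_box[OF assms(1,2)] by blast
  show ?thesis
    unfolding eventually_nhds_metric
    using d(1)
    by (intro exI[of _ d])
      (auto simp: dist_real_def intro!: d(2) eucl_update openin_Euclidean_subset[OF assms(1,2)] assms(3))
qed

definition partial_deriv :: "nat \<Rightarrow> (rvec \<Rightarrow> real) \<Rightarrow> rvec \<Rightarrow> real" where
  "partial_deriv i f x = deriv (\<lambda>s. f (x(i := s))) (x i)"

lemma has_partial_cong:
  assumes U: "openin (Euclidean_space n) U" "x \<in> U" "i < n"
    and "\<And>y. y \<in> U \<Longrightarrow> f y = g y"
  shows "((\<lambda>s. f (x(i := s))) has_real_derivative d) (at (x i)) \<longleftrightarrow>
         ((\<lambda>s. g (x(i := s))) has_real_derivative d) (at (x i))"
  by (rule DERIV_cong_ev[OF refl _ refl])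
    (use eventually_update_in[OF U] assms(4) in \<open>auto elim: eventually_mono\<close>)

lemma Cdiff_imp_continuous:
  "Cdiff n U k f \<Longrightarrow> continuous_map (subtopology (Euclidean_space n) U) euclideanreal f"
  by (cases k) (auto simp: Cdiff.simps(2))

lemma continuous_map_cong_open:
  assumes "\<And>x. x \<in> U \<Longrightarrow> f x = g x"
  shows "continuous_map (subtopology X U) Y f \<longleftrightarrow> continuous_map (subtopology X U) Y g"
  by (rule iffI; erule continuous_map_eq; use assms in auto)

text \<open>
  The definition forms \<open>f (x(i := s))\<close> for all s, also where the argument leaves U, but a derivative
  only sees the values near x, and these are values on U because U is open.
\<close>
lemma Cdiff_cong:
  assumes U: "openin (Euclidean_space n) U" and eq: "\<And>x. x \<in> U \<Longrightarrow> f x = g x"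
  shows "Cdiff n U k f \<longleftrightarrow> Cdiff n U k g"
proof (cases k)
  case 0
  then show ?thesis using continuous_map_cong_open[OF eq] by simp
next
  case (Suc k')
  have *: "((\<lambda>s. f (x(i := s))) has_real_derivative d) (at (x i)) \<longleftrightarrow>
         ((\<lambda>s. g (x(i := s))) has_real_derivative d) (at (x i))" if "x \<in> U" "i < n" for x i d
    using has_partial_cong[where f = f and g = g, OF U that eq] .
  have **: "(\<forall>i<n. (\<forall>x\<in>U. ((\<lambda>s. f (x(i := s))) has_real_derivative D i x) (at (x i))) \<and>
          Cdiff n U k' (D i)) \<longleftrightarrow> (\<forall>i<n. (\<forall>x\<in>U. ((\<lambda>s. g (x(i := s))) has_real_derivative D i x) (at (x i))) \<and>
          Cdiff n U k' (D i))" for D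
    using * by auto
  have "continuous_map (subtopology (Euclidean_space n) U) euclideanreal f \<longleftrightarrow>
        continuous_map (subtopology (Euclidean_space n) U) euclideanreal g"
    by (rule continuous_map_cong_open[OF eq])
  then show ?thesis by (simp only: Suc Cdiff.simps(2) **)
qed

lemma Cdiff_SucI:
  assumes "continuous_map (subtopology (Euclidean_space n) U) euclideanreal f"
    and "\<And>i x. i < n \<Longrightarrow> x \<in> U \<Longrightarrow> ((\<lambda>s. f (x(i := s))) has_real_derivative D i x) (at (x i))"
    and "\<And>i. i < n \<Longrightarrow> Cdiff n U k (D i)"
  shows "Cdiff n U (Suc k) f"
  unfolding Cdiff.simps(2) using assms by blast

lemma Cdiff_SucE:
  assumes "Cdiff n U (Suc k) f"
  obtains D where "continuous_map (subtopology (Euclidean_space n) U) euclideanreal f"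
    and "\<And>i x. i < n \<Longrightarrow> x \<in> U \<Longrightarrow> ((\<lambda>s. f (x(i := s))) has_real_derivative D i x) (at (x i))"
    and "\<And>i. i < n \<Longrightarrow> Cdiff n U k (D i)"
  using assms unfolding Cdiff.simps(2) by blast

text \<open>
  Any witness for the existential in the definition agrees on U with the canonical
  partial derivative. This is what allows local data to be glued in \<open>Cdiff_local\<close>: local witnesses
  are not chosen compatibly, but the canonical ones are.
\<close>
lemma Cdiff_Suc_partial:
  assumes U: "openin (Euclidean_space n) U" and f: "Cdiff n U (Suc k) f" and i: "i < n"
  shows "x \<in> U \<Longrightarrow> ((\<lambda>s. f (x(i := s))) has_real_derivative partial_deriv i f x) (at (x i))"
    and "Cdiff n U k (partial_deriv i f)"
proof -
  obtain D where D: "\<And>x. x \<in> U \<Longrightarrow> ((\<lambda>s. f (x(i := s))) has_real_derivative D x) (at (x i))"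
    and D': "Cdiff n U k D"
    using f i by (elim Cdiff_SucE) blast
  have eq: "D x = partial_deriv i f x" if "x \<in> U" for x
    using DERIV_imp_deriv[OF D[OF that]] by (simp add: partial_deriv_def)
  show "((\<lambda>s. f (x(i := s))) has_real_derivative partial_deriv i f x) (at (x i))" if "x \<in> U"
    using D[OF that] eq[OF that] by simp
  show "Cdiff n U k (partial_deriv i f)"
    using D' Cdiff_cong[where f = D and g = "partial_deriv i f", OF U eq] by simp
qed

lemma Cdiff_SucD: "Cdiff n U (Suc k) f \<Longrightarrow> Cdiff n U k f"
proof (induction k arbitrary: f)
  case (Suc k)
  then show ?case
    by (elim Cdiff_SucE[where k = "Suc k"]) (rule Cdiff_SucI; blast)
qed (auto intro: Cdiff_imp_continuous)

lemma Cdiff_const: "Cdiff n U k (\<lambda>x. c)"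
proof (induction k arbitrary: c)
  case (Suc k)
  show ?case by (rule Cdiff_SucI[where D = "\<lambda>_ _. 0"]) (auto intro: Suc)
qed simp

lemma Cdiff_add: "Cdiff n U k f \<Longrightarrow> Cdiff n U k g \<Longrightarrow> Cdiff n U k (\<lambda>x. f x + g x)"
proof (induction k arbitrary: f g)
  case (Suc k)
  obtain Df where Df: "\<And>i x. i < n \<Longrightarrow> x \<in> U \<Longrightarrow> ((\<lambda>s. f (x(i := s))) has_real_derivative Df i x) (at (x i))"
    "\<And>i. i < n \<Longrightarrow> Cdiff n U k (Df i)"
    using Suc.prems(1) by (elim Cdiff_SucE) blast
  obtain Dg where Dg: "\<And>i x. i < n \<Longrightarrow> x \<in> U \<Longrightarrow> ((\<lambda>s. g (x(i := s))) has_real_derivative Dg i x) (at (x i))"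
    "\<And>i. i < n \<Longrightarrow> Cdiff n U k (Dg i)"
    using Suc.prems(2) by (elim Cdiff_SucE) blast
  show ?case
  proof (rule Cdiff_SucI[where D = "\<lambda>i x. Df i x + Dg i x"])
    show "((\<lambda>s. f (x(i := s)) + g (x(i := s))) has_real_derivative Df i x + Dg i x) (at (x i))"
      if "i < n" "x \<in> U" for i x
      using DERIV_add[OF Df(1)[OF that] Dg(1)[OF that]] .
  qed (use Suc Df(2) Dg(2) in \<open>auto intro: continuous_map_add Cdiff_imp_continuous\<close>)
qed (auto intro: continuous_map_add)

lemma Cdiff_sum: "(\<And>j. j \<in> J \<Longrightarrow> Cdiff n U k (f j)) \<Longrightarrow> Cdiff n U k (\<lambda>x. \<Sum>j\<in>J. f j x)"
  by (induction J rule: infinite_finite_induct) (auto intro: Cdiff_add Cdiff_const)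

lemma Cdiff_mult: "Cdiff n U k f \<Longrightarrow> Cdiff n U k g \<Longrightarrow> Cdiff n U k (\<lambda>x. f x * g x)"
proof (induction k arbitrary: f g)
  case (Suc k)
  obtain Df where Df: "\<And>i x. i < n \<Longrightarrow> x \<in> U \<Longrightarrow> ((\<lambda>s. f (x(i := s))) has_real_derivative Df i x) (at (x i))"
    "\<And>i. i < n \<Longrightarrow> Cdiff n U k (Df i)"
    using Suc.prems(1) by (elim Cdiff_SucE) blast
  obtain Dg where Dg: "\<And>i x. i < n \<Longrightarrow> x \<in> U \<Longrightarrow> ((\<lambda>s. g (x(i := s))) has_real_derivative Dg i x) (at (x i))"
    "\<And>i. i < n \<Longrightarrow> Cdiff n U k (Dg i)"
    using Suc.prems(2) by (elim Cdiff_SucE) blast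
  show ?case
  proof (rule Cdiff_SucI[where D = "\<lambda>i x. Df i x * g x + Dg i x * f x"])
    show "((\<lambda>s. f (x(i := s)) * g (x(i := s))) has_real_derivative Df i x * g x + Dg i x * f x) (at (x i))"
      if "i < n" "x \<in> U" for i x
      using DERIV_mult[OF Df(1)[OF that] Dg(1)[OF that]] by simp
    show "Cdiff n U k (\<lambda>x. Df i x * g x + Dg i x * f x)" if "i < n" for i
      using Suc.prems by (intro Cdiff_add Suc.IH Df(2) Dg(2) that Cdiff_SucD[of n U k])
  qed (use Suc.prems in \<open>auto intro: continuous_map_real_mult Cdiff_imp_continuous\<close>)
qed (auto intro: continuous_map_real_mult)

lemma Cdiff_subset:
  assumes "Cdiff n U k f" "U' \<subseteq> U"
  shows "Cdiff n U' k f"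
  using assms
proof (induction k arbitrary: f)
  case 0
  then show ?case by (auto intro: continuous_map_from_subtopology_mono)
next
  case (Suc k)
  then obtain D where D: "\<And>i x. i < n \<Longrightarrow> x \<in> U \<Longrightarrow> ((\<lambda>s. f (x(i := s))) has_real_derivative D i x) (at (x i))"
    "\<And>i. i < n \<Longrightarrow> Cdiff n U k (D i)"
    by (elim Cdiff_SucE) blast
  show ?case
  proof (rule Cdiff_SucI[where D = D])
    show "((\<lambda>s. f (x(i := s))) has_real_derivative D i x) (at (x i))" if "i < n" "x \<in> U'" for i x
      using D(1) that Suc.prems(2) by blast
  qed (use Suc D(2) in \<open>auto intro: continuous_map_from_subtopology_mono Cdiff_imp_continuous\<close>)
qed

lemma continuous_map_local:
  assumes U: "openin X U"
    and loc: "\<And>x. x \<in> U \<Longrightarrow> \<exists>U'\<subseteq>U. openin X U' \<and> x \<in> U' \<and> continuous_map (subtopology X U') Y f"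
  shows "continuous_map (subtopology X U) Y f"
proof -
  obtain V where V: "\<And>x. x \<in> U \<Longrightarrow> V x \<subseteq> U \<and> openin X (V x) \<and> x \<in> V x \<and> continuous_map (subtopology X (V x)) Y f"
    using loc by metis
  show ?thesis
  proof (rule pasting_lemma[where I = U and T = V and f = "\<lambda>_. f"])
    show "openin (subtopology X U) (V i)" if "i \<in> U" for i
      using V[OF that] U by (simp add: openin_open_subtopology)
    show "continuous_map (subtopology (subtopology X U) (V i)) Y f" if "i \<in> U" for i
      using V[OF that] by (simp add: subtopology_subtopology Int_absorb1)
    show "\<exists>j. j \<in> U \<and> x \<in> V j \<and> f x = f x" if "x \<in> topspace (subtopology X U)" for x
      using that V by auto
  qed auto
qed

lemma Cdiff_local:
  assumes U: "openin (Euclidean_space n) U"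
    and loc: "\<And>x. x \<in> U \<Longrightarrow> \<exists>U'\<subseteq>U. openin (Euclidean_space n) U' \<and> x \<in> U' \<and> Cdiff n U' k f"
  shows "Cdiff n U k f"
  using loc
proof (induction k arbitrary: f)
  case 0
  show ?case using 0 continuous_map_local[OF U, of euclideanreal f] by simp
next
  case (Suc k)
  have "\<exists>U'\<subseteq>U. openin (Euclidean_space n) U' \<and> x \<in> U' \<and> Cdiff n U' k (partial_deriv i f)"
    if "i < n" "x \<in> U" for i x
    using Suc.prems[OF that(2)] that(1) by (blast intro: Cdiff_Suc_partial)
  moreover have "((\<lambda>s. f (x(i := s))) has_real_derivative partial_deriv i f x) (at (x i))"
    if "i < n" "x \<in> U" for i x
    using Suc.prems[OF that(2)] that(1) by (blast intro: Cdiff_Suc_partial)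
  moreover have "continuous_map (subtopology (Euclidean_space n) U) euclideanreal f"
  proof (rule continuous_map_local[OF U])
    fix x assume "x \<in> U"
    from Suc.prems[OF this] obtain U' where
      "U' \<subseteq> U" "openin (Euclidean_space n) U'" "x \<in> U'" "Cdiff n U' (Suc k) f"
      by blast
    then show "\<exists>U'\<subseteq>U. openin (Euclidean_space n) U' \<and> x \<in> U' \<and>
        continuous_map (subtopology (Euclidean_space n) U') euclideanreal f"
      by (intro exI[of _ U']) (simp add: Cdiff_imp_continuous)
  qed
  ultimately show ?case
    by (intro Cdiff_SucI[where D = "\<lambda>i. partial_deriv i f"] Suc.IH)
qed

text \<open>
  The coordinates from m on vanish identically, so that they are continuous for free.
\<close>
lemma continuous_into_Euclidean:
  assumes "\<And>x. x \<in> topspace X \<Longrightarrow> f x \<in> eucl m"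
    and "\<And>j. j < m \<Longrightarrow> continuous_map X euclideanreal (\<lambda>x. f x j)"
  shows "continuous_map X (Euclidean_space m) f"
proof -
  have "continuous_map X euclideanreal (\<lambda>x. f x j)" for j
  proof (cases "j < m")
    case False
    then have "f x j = 0" if "x \<in> topspace X" for x
      using assms(1)[OF that] by (simp add: topspace_Euclidean_space)
    then show ?thesis using continuous_map_eq[of X euclideanreal "\<lambda>_. 0" "\<lambda>x. f x j"] by simp
  qed (rule assms(2))
  then show ?thesis
    using assms(1) by (auto simp: Euclidean_space_def continuous_map_in_subtopology
        continuous_map_componentwise_UNIV)
qed

text \<open>
  Continuous partial derivatives give differentiability. The increment from \<open>y0\<close> to y is
  telescoped through the points \<open>z l\<close> that agree with y in the first l coordinates and with \<open>y0\<close> in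
  the others; each step changes a single coordinate, and the mean value inequality bounds its
  deviation from the linear term by the oscillation of one partial derivative times the increment of
  that coordinate.
\<close>
lemma linear_approximation:
  assumes V: "openin (Euclidean_space m) V" and y0: "y0 \<in> V"
    and der: "\<And>j y. j < m \<Longrightarrow> y \<in> V \<Longrightarrow> ((\<lambda>s. f (y(j := s))) has_real_derivative D j y) (at (y j))"
    and cont: "\<And>j. j < m \<Longrightarrow> continuous_map (subtopology (Euclidean_space m) V) euclideanreal (D j)"
    and e: "e > 0"
  obtains d where "d > 0"
    "\<And>y. \<lbrakk>y \<in> eucl m; \<And>j. j < m \<Longrightarrow> \<bar>y j - y0 j\<bar> < d\<rbrakk> \<Longrightarrow>
       \<bar>f y - f y0 - (\<Sum>j<m. D j y0 * (y j - y0 j))\<bar> \<le> e * (\<Sum>j<m. \<bar>y j - y0 j\<bar>)"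
proof -
  define W where "W = V \<inter> (\<Inter>j\<in>{..<m}. {y \<in> V. \<bar>D j y - D j y0\<bar> < e})"
  have "openin (Euclidean_space m) {y \<in> V. \<bar>D j y - D j y0\<bar> < e}" if "j < m" for j
  proof -
    have "openin (subtopology (Euclidean_space m) V)
            {y \<in> topspace (subtopology (Euclidean_space m) V). D j y \<in> {s. \<bar>s - D j y0\<bar> < e}}"
      by (rule openin_continuous_map_preimage[OF cont[OF that]])
        (auto intro!: open_Collect_less continuous_intros)
    moreover have "topspace (subtopology (Euclidean_space m) V) = V"
      using openin_subset[OF V] by auto
    ultimately show ?thesis using V by (simp only: openin_open_subtopology) simp
  qed
  then have "openin (Euclidean_space m) W"
    unfolding W_def using V
    by (cases "m = 0") (auto intro!: openin_Int openin_INT simp del: Inter_iff)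
  moreover have "y0 \<in> W" using y0 e by (auto simp: W_def)
  ultimately obtain d where d: "d > 0" "\<And>y. \<lbrakk>y \<in> eucl m; \<And>j. j < m \<Longrightarrow> \<bar>y j - y0 j\<bar> < d\<rbrakk> \<Longrightarrow> y \<in> W"
    using openin_Euclidean_box by blast
  show ?thesis
  proof
    fix y assume y: "y \<in> eucl m" "\<And>j. j < m \<Longrightarrow> \<bar>y j - y0 j\<bar> < d"
    have y0': "y0 \<in> eucl m" using openin_Euclidean_subset[OF V y0] .
    define z where "z l = (\<lambda>i. if i < l then y i else y0 i)" for l :: nat
    have "\<bar>f (z l) - f y0 - (\<Sum>j<l. D j y0 * (y j - y0 j))\<bar> \<le> e * (\<Sum>j<l. \<bar>y j - y0 j\<bar>)" if "l \<le> m" for l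
      using that
    proof (induction l)
      case 0
      then show ?case by (simp add: z_def)
    next
      case (Suc l)
      define S where "S = closed_segment (y0 l) (y l)"
      have inW: "(z l)(l := s) \<in> W" if "s \<in> S" for s
      proof (rule d(2))
        show "(z l)(l := s) \<in> eucl m"
          using y(1) y0' Suc.prems by (auto simp: topspace_Euclidean_space z_def)
        have "\<bar>s - y0 l\<bar> \<le> \<bar>y l - y0 l\<bar>"
          using that unfolding S_def closed_segment_eq_real_ivl by (auto split: if_splits)
        then show "\<bar>((z l)(l := s)) j - y0 j\<bar> < d" if "j < m" for j
          using y(2)[OF that] d(1) by (auto simp: z_def)
      qed
      (* The function s \<mapsto> f (z l with s in coordinate l) minus its linear term has
         derivative at most e in absolute value along the segment. *)
      have "norm ((f ((z l)(l := y l)) - D l y0 * y l) - (f ((z l)(l := y0 l)) - D l y0 * y0 l)) \<le> e * norm (y l - y0 l)"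
      proof (rule field_differentiable_bound[where S = S
            and f = "\<lambda>s. f ((z l)(l := s)) - D l y0 * s"
            and f' = "\<lambda>s. D l ((z l)(l := s)) - D l y0"])
        fix s assume s: "s \<in> S"
        have "((\<lambda>s. f ((z l)(l := s))) has_real_derivative D l ((z l)(l := s))) (at s)"
          using der[of l "(z l)(l := s)"] inW[OF s] Suc.prems by (auto simp: W_def)
        then show "((\<lambda>s. f ((z l)(l := s)) - D l y0 * s) has_real_derivative D l ((z l)(l := s)) - D l y0) (at s within S)"
          by (auto intro!: derivative_eq_intros intro: has_field_derivative_at_within)
        show "norm (D l ((z l)(l := s)) - D l y0) \<le> e"
          using inW[OF s] Suc.prems by (simp add: W_def Suc_le_eq order_less_imp_le)
      qed (auto simp: S_def)
      moreover have "(z l)(l := y l) = z (Suc l)" "(z l)(l := y0 l) = z l"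
        by (auto simp: z_def fun_eq_iff less_Suc_eq)
      moreover have "\<bar>f (z l) - f y0 - (\<Sum>j<l. D j y0 * (y j - y0 j))\<bar> \<le> e * (\<Sum>j<l. \<bar>y j - y0 j\<bar>)"
        using Suc by simp
      ultimately show ?case by (simp add: algebra_simps)
    qed
    from this[of m] show "\<bar>f y - f y0 - (\<Sum>j<m. D j y0 * (y j - y0 j))\<bar> \<le> e * (\<Sum>j<m. \<bar>y j - y0 j\<bar>)"
    proof -
      have "z m = y"
        using y(1) y0' by (auto simp: z_def fun_eq_iff topspace_Euclidean_space)
      then show ?thesis
        using \<open>m \<le> m \<Longrightarrow> _\<close> by simp
    qed
  qed (rule d(1))
qed

text \<open>
  The remainder of the linear approximation is at most e times the sum of the absolute coordinate
  increments. Divided by \<open>\<bar>s - s0\<bar>\<close> that sum converges to \<open>M = (\<Sum>j<m. \<bar>\<gamma>' j\<bar>)\<close>, so that the remainder has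
  derivative 0 at \<open>s0\<close>, and only the linear part contributes.
\<close>
lemma chain_rule_partials:
  assumes V: "openin (Euclidean_space m) V"
    and der: "\<And>j y. j < m \<Longrightarrow> y \<in> V \<Longrightarrow> ((\<lambda>s. f (y(j := s))) has_real_derivative D j y) (at (y j))"
    and cont: "\<And>j. j < m \<Longrightarrow> continuous_map (subtopology (Euclidean_space m) V) euclideanreal (D j)"
    and \<gamma>V: "\<gamma> s0 \<in> V" and \<gamma>e: "eventually (\<lambda>s. \<gamma> s \<in> eucl m) (at s0)"
    and \<gamma>': "\<And>j. j < m \<Longrightarrow> ((\<lambda>s. \<gamma> s j) has_real_derivative \<gamma>' j) (at s0)"
  shows "((\<lambda>s. f (\<gamma> s)) has_real_derivative (\<Sum>j<m. D j (\<gamma> s0) * \<gamma>' j)) (at s0)"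
proof -
  define L where "L s = (\<Sum>j<m. D j (\<gamma> s0) * (\<gamma> s j - \<gamma> s0 j))" for s
  define R where "R s = f (\<gamma> s) - f (\<gamma> s0) - L s" for s
  have "(L has_real_derivative (\<Sum>j<m. D j (\<gamma> s0) * \<gamma>' j)) (at s0)"
    unfolding L_def by (auto intro!: derivative_eq_intros \<gamma>' sum.cong)
  moreover have "(R has_real_derivative 0) (at s0)"
  proof -
    define q where "q s = (\<Sum>j<m. \<bar>(\<gamma> s j - \<gamma> s0 j) / (s - s0)\<bar>)" for s
    define M where "M = (\<Sum>j<m. \<bar>\<gamma>' j\<bar>)"
    have M: "M \<ge> 0" by (simp add: M_def sum_nonneg)
    have "(q \<longlongrightarrow> M) (at s0)"
      unfolding q_def M_def
      by (intro tendsto_sum tendsto_rabs) (use \<gamma>' in \<open>auto simp: has_field_derivative_iff\<close>)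
    then have qM: "eventually (\<lambda>s. q s < M + 1) (at s0)"
      by (rule order_tendstoD) simp
    have "((\<lambda>s. (R s - R s0) / (s - s0)) \<longlongrightarrow> 0) (at s0)"
    proof (rule tendstoI)
      fix \<epsilon> :: real assume \<epsilon>: "\<epsilon> > 0"
      (* Near s0 the difference quotients sum up to less than M + 1. *)
      define e where "e = \<epsilon> / (M + 1)"
      have e: "e > 0" using \<epsilon> M by (simp add: e_def)
      obtain d where d: "d > 0"
        "\<And>y. \<lbrakk>y \<in> eucl m; \<And>j. j < m \<Longrightarrow> \<bar>y j - \<gamma> s0 j\<bar> < d\<rbrakk> \<Longrightarrow>
         \<bar>f y - f (\<gamma> s0) - (\<Sum>j<m. D j (\<gamma> s0) * (y j - \<gamma> s0 j))\<bar> \<le> e * (\<Sum>j<m. \<bar>y j - \<gamma> s0 j\<bar>)"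
        by (rule linear_approximation[OF V \<gamma>V, of f D e]) (use der cont e in blast)+
      have "eventually (\<lambda>s. \<bar>\<gamma> s j - \<gamma> s0 j\<bar> < d) (at s0)" if "j < m" for j
        using tendstoD[OF isContD[OF DERIV_isCont[OF \<gamma>'[OF that]]] d(1)] by (simp add: dist_real_def)
      then have "eventually (\<lambda>s. \<forall>j\<in>{..<m}. \<bar>\<gamma> s j - \<gamma> s0 j\<bar> < d) (at s0)"
        by (intro eventually_ball_finite) auto
      then show "eventually (\<lambda>s. dist ((R s - R s0) / (s - s0)) 0 < \<epsilon>) (at s0)"
        using \<gamma>e qM eventually_neq_at_within[of s0 s0 UNIV]
      proof eventually_elim
        case (elim s)
        have "\<bar>R s\<bar> \<le> e * (\<Sum>j<m. \<bar>\<gamma> s j - \<gamma> s0 j\<bar>)"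
          unfolding R_def L_def using elim by (intro d(2)) auto
        then have "\<bar>R s\<bar> / \<bar>s - s0\<bar> \<le> e * (\<Sum>j<m. \<bar>\<gamma> s j - \<gamma> s0 j\<bar>) / \<bar>s - s0\<bar>"
          by (intro divide_right_mono) auto
        also have "\<dots> = e * q s"
          by (simp add: q_def flip: sum_divide_distrib)
        also have "\<dots> < e * (M + 1)" using elim e by simp
        also have "\<dots> = \<epsilon>" using M by (simp add: e_def)
        finally show ?case by (simp add: dist_real_def R_def L_def)
      qed
    qed
    then show ?thesis by (simp add: has_field_derivative_iff)
  qed
  ultimately have "((\<lambda>s. f (\<gamma> s0) + L s + R s) has_real_derivative (\<Sum>j<m. D j (\<gamma> s0) * \<gamma>' j)) (at s0)"
    by (auto intro!: derivative_eq_intros)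
  then show ?thesis by (simp add: R_def)
qed

lemma smooth_on_continuous:
  assumes "smooth_on n U m g" "g \<in> U \<rightarrow> eucl m"
  shows "continuous_map (subtopology (Euclidean_space n) U) (Euclidean_space m) g"
proof (rule continuous_into_Euclidean)
  show "continuous_map (subtopology (Euclidean_space n) U) euclideanreal (\<lambda>x. g x j)" if "j < m" for j
    using assms(1) that unfolding smooth_on_def by (blast intro: Cdiff_imp_continuous[where k = 0])
qed (use assms(2) in auto)

text \<open>
  The induction uses that a partial derivative of the composite is a sum of products of
  functions that are one order less smooth, of which one factor is again a composite with g.
\<close>
lemma Cdiff_compose:
  assumes U: "openin (Euclidean_space n) U" and V: "openin (Euclidean_space m) V"
    and g: "g \<in> U \<rightarrow> V" "\<And>j. j < m \<Longrightarrow> Cdiff n U k (\<lambda>x. g x j)" and f: "Cdiff m V k f"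
  shows "Cdiff n U k (\<lambda>x. f (g x))"
  using g(2) f
proof (induction k arbitrary: f)
  have cont: "continuous_map (subtopology (Euclidean_space n) U) euclideanreal (\<lambda>x. f (g x))"
    if "\<And>j. j < m \<Longrightarrow> Cdiff n U k (\<lambda>x. g x j)" "Cdiff m V k f" for k f
  proof -
    have "continuous_map (subtopology (Euclidean_space n) U) (Euclidean_space m) g"
    proof (rule continuous_into_Euclidean)
      show "g x \<in> eucl m" if "x \<in> topspace (subtopology (Euclidean_space n) U)" for x
        using that g(1) by (intro openin_Euclidean_subset[OF V]) auto
    qed (rule Cdiff_imp_continuous[OF that(1)])
    then have "continuous_map (subtopology (Euclidean_space n) U) (subtopology (Euclidean_space m) V) g"
      using g(1) by (auto simp: continuous_map_in_subtopology)
    from continuous_map_compose[OF this Cdiff_imp_continuous[OF that(2)]]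
    show ?thesis by (simp add: o_def)
  qed
  {
    case 0
    then show ?case using cont[of 0 f] by simp
  next
    case (Suc k)
    have pg: "((\<lambda>s. g (x(i := s)) j) has_real_derivative partial_deriv i (\<lambda>x. g x j) x) (at (x i))"
      if "i < n" "j < m" "x \<in> U" for i j x
      using Cdiff_Suc_partial[OF U Suc.prems(1)] that by blast
    have pf: "((\<lambda>s. f (y(j := s))) has_real_derivative partial_deriv j f y) (at (y j))"
      if "j < m" "y \<in> V" for j y
      using Cdiff_Suc_partial[OF V Suc.prems(2)] that by blast
    have pf': "Cdiff m V k (partial_deriv j f)" if "j < m" for j
      using Cdiff_Suc_partial[OF V Suc.prems(2)] that by blast
    have pg': "Cdiff n U k (partial_deriv i (\<lambda>x. g x j))" if "i < n" "j < m" for i j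
      using Cdiff_Suc_partial[OF U Suc.prems(1)] that by blast+
    show ?case
    proof (rule Cdiff_SucI[where D = "\<lambda>i x. \<Sum>j<m. partial_deriv j f (g x) * partial_deriv i (\<lambda>x. g x j) x"])
      show "continuous_map (subtopology (Euclidean_space n) U) euclideanreal (\<lambda>x. f (g x))"
        using cont[OF Suc.prems] .
      show "((\<lambda>s. f (g (x(i := s)))) has_real_derivative
              (\<Sum>j<m. partial_deriv j f (g x) * partial_deriv i (\<lambda>x. g x j) x)) (at (x i))"
        if ix: "i < n" "x \<in> U" for i x
      proof -
        have "eventually (\<lambda>s. g (x(i := s)) \<in> eucl m) (at (x i))"
          unfolding eventually_at_filter
          using eventually_update_in[OF U ix(2,1)]
          by eventually_elim (use g(1) in \<open>blast intro: openin_Euclidean_subset[OF V]\<close>)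
        from chain_rule_partials[where \<gamma> = "\<lambda>s. g (x(i := s))" and ?s0.0 = "x i", OF V pf Cdiff_imp_continuous[OF pf'] _ this]
        show ?thesis using g(1) ix pg[OF ix(1) _ ix(2)] by (simp add: Pi_iff)
      qed
      show "Cdiff n U k (\<lambda>x. \<Sum>j<m. partial_deriv j f (g x) * partial_deriv i (\<lambda>x. g x j) x)"
        if "i < n" for i
      proof (rule Cdiff_sum, rule Cdiff_mult)
        fix j assume j: "j \<in> {..<m}"
        show "Cdiff n U k (\<lambda>x. partial_deriv j f (g x))"
          using j by (intro Suc.IH[OF Cdiff_SucD[OF Suc.prems(1)]] pf') auto
        show "Cdiff n U k (\<lambda>x. partial_deriv i (\<lambda>x. g x j) x)"
          using pg'[OF that] j by simp
      qed
    qed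
  }
qed

lemma smooth_on_compose:
  assumes "openin (Euclidean_space n) U" "openin (Euclidean_space m) V"
    and "g \<in> U \<rightarrow> V" "smooth_on n U m g" "smooth_on m V l f"
  shows "smooth_on n U l (\<lambda>x. f (g x))"
  unfolding smooth_on_def
proof (intro allI impI)
  show "Cdiff n U k (\<lambda>x. f (g x) j)" if "j < l" for j k
    using Cdiff_compose[OF assms(1-3), of k "\<lambda>y. f y j"] assms(4,5) that
    unfolding smooth_on_def by blast
qed

lemma smooth_on_cong:
  assumes "openin (Euclidean_space n) U" "\<And>x. x \<in> U \<Longrightarrow> f x = g x"
  shows "smooth_on n U m f \<longleftrightarrow> smooth_on n U m g"
proof -
  have "Cdiff n U k (\<lambda>x. f x j) \<longleftrightarrow> Cdiff n U k (\<lambda>x. g x j)" for k j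
    by (rule Cdiff_cong[OF assms(1)]) (simp add: assms(2))
  then show ?thesis by (simp only: smooth_on_def)
qed

lemma smooth_on_subset: "smooth_on n U m f \<Longrightarrow> U' \<subseteq> U \<Longrightarrow> smooth_on n U' m f"
  unfolding smooth_on_def by (auto intro: Cdiff_subset[of n U _ _ U'])

lemma smooth_on_local:
  assumes U: "openin (Euclidean_space n) U"
    and loc: "\<And>x. x \<in> U \<Longrightarrow> \<exists>U'\<subseteq>U. openin (Euclidean_space n) U' \<and> x \<in> U' \<and> smooth_on n U' m f"
  shows "smooth_on n U m f"
  unfolding smooth_on_def
proof (intro allI impI)
  show "Cdiff n U k (\<lambda>x. f x j)" if "j < m" for j k
  proof (rule Cdiff_local[OF U])
    fix x assume "x \<in> U"
    from loc[OF this] obtain U' where "U' \<subseteq> U" "openin (Euclidean_space n) U'" "x \<in> U'" "smooth_on n U' m f"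
      by blast
    then show "\<exists>U'\<subseteq>U. openin (Euclidean_space n) U' \<and> x \<in> U' \<and> Cdiff n U' k (\<lambda>x. f x j)"
      using that by (intro exI[of _ U']) (simp add: smooth_on_def)
  qed
qed

text \<open>
  Freezing the first k coordinates: the partial derivative in direction i of the slice is the
  partial derivative in direction \<open>k + i\<close> of the original map.
\<close>
lemma smooth_on_slice:
  assumes P: "openin (Euclidean_space k) P" "p \<in> P" and U: "openin (Euclidean_space n) U"
    and f: "smooth_on (k + n) (vprod k P U) m f"
  shows "smooth_on n U m (\<lambda>u. f (vappend k p u))"
proof -
  have "continuous_map (subtopology (Euclidean_space n) U) (Euclidean_space (k + n)) (vappend k p)"
  proof (rule continuous_into_Euclidean)
    show "vappend k p u \<in> eucl (k + n)" if "u \<in> topspace (subtopology (Euclidean_space n) U)" for u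
      using that by (auto simp: vappend_def topspace_Euclidean_space)
    show "continuous_map (subtopology (Euclidean_space n) U) euclideanreal (\<lambda>u. vappend k p u j)"
      for j
    proof (cases "j < k")
      case False
      then show ?thesis
        unfolding Euclidean_space_def vappend_def
        using continuous_map_product_projection[of "j - k" UNIV "\<lambda>_. euclideanreal"]
        by (simp add: continuous_map_from_subtopology)
    qed (simp add: vappend_def)
  qed
  then have c: "continuous_map (subtopology (Euclidean_space n) U)
      (subtopology (Euclidean_space (k + n)) (vprod k P U)) (vappend k p)"
    using P(2) by (auto simp: continuous_map_in_subtopology vprod_def)
  have "Cdiff n U K (\<lambda>u. h (vappend k p u))" if "Cdiff (k + n) (vprod k P U) K h" for K h
    using that
  proof (induction K arbitrary: h)
    case 0
    then show ?case using continuous_map_compose[OF c, of euclideanreal h] by (simp add: o_def)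
  next
    case (Suc K)
    then obtain D where D: "\<And>i x. i < k + n \<Longrightarrow> x \<in> vprod k P U \<Longrightarrow> ((\<lambda>s. h (x(i := s))) has_real_derivative D i x) (at (x i))"
    "\<And>i. i < k + n \<Longrightarrow> Cdiff (k + n) (vprod k P U) K (D i)"
      by (elim Cdiff_SucE) blast
    have upd: "vappend k p (u(i := s)) = (vappend k p u)(k + i := s)" for u i s
      by (auto simp: vappend_def fun_eq_iff)
    have val: "vappend k p u (k + i) = u i" for u i
      by (simp add: vappend_def)
    have mem: "vappend k p u \<in> vprod k P U" if "u \<in> U" for u
      using P(2) that by (auto simp: vprod_def)
    show ?case
    proof (rule Cdiff_SucI[where D = "\<lambda>i u. D (k + i) (vappend k p u)"])
      show "continuous_map (subtopology (Euclidean_space n) U) euclideanreal (\<lambda>u. h (vappend k p u))"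
        using continuous_map_compose[OF c Cdiff_imp_continuous[OF Suc.prems]] by (simp add: o_def)
      show "((\<lambda>s. h (vappend k p (u(i := s)))) has_real_derivative D (k + i) (vappend k p u)) (at (u i))"
        if "i < n" "u \<in> U" for i u
        using D(1)[of "k + i" "vappend k p u"] that mem by (simp only: upd val add_less_cancel_left)
      show "Cdiff n U K (\<lambda>u. D (k + i) (vappend k p u))" if "i < n" for i
        using Suc.IH D(2) that by simp
    qed
  qed
  note slice = this
  show ?thesis
    unfolding smooth_on_def
  proof (intro allI impI)
    show "Cdiff n U K (\<lambda>u. f (vappend k p u) j)" if "j < m" for j K
      using slice[of K "\<lambda>x. f x j"] f that unfolding smooth_on_def by blast
  qed
qed

section \<open>The smooth site and its representables\<close>

lemma mem_objects_smooth: "A \<in> objects smooth_site \<longleftrightarrow> openin (Euclidean_space (fst A)) (snd A)"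
  by (cases A) (simp add: smooth_site_def)

lemma mem_mors_smooth:
  "f \<in> mors smooth_site A B \<longleftrightarrow>
     f \<in> snd A \<rightarrow>\<^sub>E snd B \<and> smooth_on (fst A) (snd A) (fst B) f"
  by (cases A; cases B) (simp add: smooth_site_def)

lemma covers_smooth: "covers smooth_site = open_covers Euclidean_space"
  by (simp add: smooth_site_def)

lemma smooth_site_restrict:
  assumes "A \<in> objects smooth_site" "fst B = fst A" "snd B \<subseteq> snd A"
    "openin (Euclidean_space (fst A)) (snd B)" "f \<in> mors smooth_site A C"
  shows "restrict f (snd B) \<in> mors smooth_site B C"
proof -
  have "smooth_on (fst B) (snd B) (fst C) (restrict f (snd B)) \<longleftrightarrow>
        smooth_on (fst B) (snd B) (fst C) f"
    using assms by (intro smooth_on_cong) auto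
  moreover have "smooth_on (fst B) (snd B) (fst C) f"
    using assms by (auto simp: mem_mors_smooth intro: smooth_on_subset)
  ultimately show ?thesis
    using assms(3,5) by (auto simp: mem_mors_smooth PiE_iff)
qed

lemma smooth_site_const:
  assumes A: "A \<in> objects smooth_site" and c: "c \<in> snd B"
  shows "(\<lambda>a\<in>snd A. c) \<in> mors smooth_site A B"
proof -
  have "smooth_on (fst A) (snd A) (fst B) (\<lambda>a\<in>snd A. c) \<longleftrightarrow>
        smooth_on (fst A) (snd A) (fst B) (\<lambda>a. c)"
    using A by (intro smooth_on_cong) (auto simp: mem_objects_smooth)
  then show ?thesis
    using c by (simp add: mem_mors_smooth smooth_on_def Cdiff_const)
qed

lemma smooth_site_compose:
  assumes "A \<in> objects smooth_site" "B \<in> objects smooth_site"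
    "f \<in> mors smooth_site A B" "g \<in> mors smooth_site B C"
  shows "compose (snd A) g f \<in> mors smooth_site A C"
proof -
  have "smooth_on (fst A) (snd A) (fst C) (compose (snd A) g f) \<longleftrightarrow>
        smooth_on (fst A) (snd A) (fst C) (\<lambda>x. g (f x))"
    using assms(1) by (intro smooth_on_cong) (auto simp: mem_objects_smooth compose_eq)
  moreover have "smooth_on (fst A) (snd A) (fst C) (\<lambda>x. g (f x))"
    by (rule smooth_on_compose[of _ _ "fst B" "snd B"])
      (use assms in \<open>auto simp: mem_objects_smooth mem_mors_smooth\<close>)
  ultimately show ?thesis
    using assms(3,4) by (auto simp: mem_mors_smooth compose_def PiE_iff)
qed

lemma smooth_site_coverE:
  assumes "A \<in> objects smooth_site" "\<C> \<in> covers smooth_site A" "x \<in> snd A"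
  obtains B where "B \<in> \<C>" "x \<in> snd B" "fst B = fst A" "snd B \<subseteq> snd A"
    "openin (Euclidean_space (fst A)) (snd B)"
proof -
  have \<C>: "\<forall>B\<in>\<C>. fst B = fst A \<and> openin (subtopology (Euclidean_space (fst A)) (snd A)) (snd B)"
    and "(\<Union>B\<in>\<C>. snd B) = snd A"
    using assms(2) by (simp_all add: covers_smooth open_covers_def)
  then obtain B where "B \<in> \<C>" "x \<in> snd B"
    using assms(3) by blast
  then show thesis
    using \<C> assms(1) that by (auto simp: mem_objects_smooth openin_open_subtopology)
qed

lemma smooth_site_glue:
  assumes A: "A \<in> objects smooth_site" and f: "f \<in> snd A \<rightarrow>\<^sub>E snd B"
    and \<C>: "\<C> \<in> covers smooth_site A"
    and loc: "\<And>C. C \<in> \<C> \<Longrightarrow> restrict f (snd C) \<in> mors smooth_site C B"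
  shows "f \<in> mors smooth_site A B"
proof -
  have U: "openin (Euclidean_space (fst A)) (snd A)"
    using A by (simp add: mem_objects_smooth)
  have "smooth_on (fst A) (snd A) (fst B) f"
  proof (rule smooth_on_local[OF U])
    fix x assume "x \<in> snd A"
    then obtain C where C: "C \<in> \<C>" "x \<in> snd C"
      and C': "fst C = fst A" "snd C \<subseteq> snd A" "openin (Euclidean_space (fst A)) (snd C)"
      using smooth_site_coverE[OF A \<C>] by metis
    have "smooth_on (fst A) (snd C) (fst B) (restrict f (snd C))"
      using loc[OF C(1)] C'(1) by (simp add: mem_mors_smooth)
    then have "smooth_on (fst A) (snd C) (fst B) f"
      by (subst (asm) smooth_on_cong[OF C'(3), of _ f]) auto
    then show "\<exists>U'\<subseteq>snd A. openin (Euclidean_space (fst A)) U' \<and> x \<in> U' \<and>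
        smooth_on (fst A) U' (fst B) f"
      using C C' by blast
  qed
  then show ?thesis using f by (simp add: mem_mors_smooth)
qed

lemma representable_is_diff_space:
  assumes "A \<in> objects smooth_site"
  shows "is_diff_space (representable smooth_site A)"
  unfolding concrete_sheaf_def representable_def cspace.simps
proof (intro conjI ballI impI)
  show "mors smooth_site B A \<subseteq> snd B \<rightarrow>\<^sub>E snd A" for B
    by (auto simp: mem_mors_smooth)
qed (blast intro: smooth_site_const smooth_site_compose smooth_site_glue)+

lemma mors_are_smooth_maps:
  assumes "A \<in> objects smooth_site" "f \<in> mors smooth_site A B"
  shows "f \<in> smooth_maps (representable smooth_site A) (representable smooth_site B)"
  using assms by (auto simp: sheaf_maps_def representable_def intro: smooth_site_compose)
    (auto simp: mem_mors_smooth)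

text \<open>
  Needed to pull back the domains of local lifts along a morphism of the site.
\<close>
lemma smooth_site_preimage:
  assumes A: "A \<in> objects smooth_site" and B: "B \<in> objects smooth_site"
    and f: "f \<in> mors smooth_site A B" and W: "openin (Euclidean_space (fst B)) W"
  shows "openin (Euclidean_space (fst A)) {x \<in> snd A. f x \<in> W}"
proof -
  have U: "openin (Euclidean_space (fst A)) (snd A)"
    using A by (simp add: mem_objects_smooth)
  have "f \<in> snd A \<rightarrow> eucl (fst B)"
    using f B openin_subset by (fastforce simp: mem_mors_smooth mem_objects_smooth)
  then have "continuous_map (subtopology (Euclidean_space (fst A)) (snd A)) (Euclidean_space (fst B)) f"
    using f by (intro smooth_on_continuous) (auto simp: mem_mors_smooth)
  from openin_continuous_map_preimage[OF this W]
  have "openin (subtopology (Euclidean_space (fst A)) (snd A)) {x \<in> snd A. f x \<in> W}"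
    using openin_subset[OF U] by (simp add: Int_absorb1)
  then show ?thesis using U by (simp add: openin_open_subtopology)
qed

section \<open>Concrete sheaves and their morphisms\<close>

lemma concrete_sheafD:
  assumes "concrete_sheaf S X" "A \<in> objects S"
  shows "p \<in> sections X A \<Longrightarrow> p \<in> snd A \<rightarrow>\<^sub>E points X"
    and "c \<in> points X \<Longrightarrow> (\<lambda>a\<in>snd A. c) \<in> sections X A"
    and "B \<in> objects S \<Longrightarrow> f \<in> mors S A B \<Longrightarrow> q \<in> sections X B \<Longrightarrow> compose (snd A) q f \<in> sections X A"
    and "\<C> \<in> covers S A \<Longrightarrow> p \<in> snd A \<rightarrow>\<^sub>E points X \<Longrightarrow>
      (\<And>B. B \<in> \<C> \<Longrightarrow> restrict p (snd B) \<in> sections X B) \<Longrightarrow> p \<in> sections X A"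
proof -
  note sheaf = assms(1)[unfolded concrete_sheaf_def]
  show "p \<in> sections X A \<Longrightarrow> p \<in> snd A \<rightarrow>\<^sub>E points X"
    using conjunct1[OF sheaf] assms(2) by blast
  show "c \<in> points X \<Longrightarrow> (\<lambda>a\<in>snd A. c) \<in> sections X A"
    using conjunct1[OF conjunct2[OF sheaf]] assms(2) by blast
  show "B \<in> objects S \<Longrightarrow> f \<in> mors S A B \<Longrightarrow> q \<in> sections X B \<Longrightarrow>
      compose (snd A) q f \<in> sections X A"
    using conjunct1[OF conjunct2[OF conjunct2[OF sheaf]]] assms(2) by blast
  show "\<C> \<in> covers S A \<Longrightarrow> p \<in> snd A \<rightarrow>\<^sub>E points X \<Longrightarrow>
      (\<And>B. B \<in> \<C> \<Longrightarrow> restrict p (snd B) \<in> sections X B) \<Longrightarrow> p \<in> sections X A"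
    using conjunct2[OF conjunct2[OF conjunct2[OF sheaf]]] assms(2) by blast
qed

lemma sheaf_mapsD:
  assumes "g \<in> sheaf_maps S X Y"
  shows "g \<in> points X \<rightarrow>\<^sub>E points Y"
    and "A \<in> objects S \<Longrightarrow> p \<in> sections X A \<Longrightarrow> compose (snd A) g p \<in> sections Y A"
  using assms by (simp_all add: sheaf_maps_def)

lemma sheaf_maps_ident:
  assumes "concrete_sheaf S X"
  shows "(\<lambda>x\<in>points X. x) \<in> sheaf_maps S X X"
proof -
  have "compose (snd A) (\<lambda>x\<in>points X. x) p = p" if "A \<in> objects S" "p \<in> sections X A" for A p
    using concrete_sheafD(1)[OF assms that] by (auto simp: compose_def PiE_iff extensional_def fun_eq_iff)
  then show ?thesis by (auto simp: sheaf_maps_def)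
qed

lemma sheaf_maps_compose:
  assumes "concrete_sheaf S X" "g \<in> sheaf_maps S X Y" "h \<in> sheaf_maps S Y Z"
  shows "compose (points X) h g \<in> sheaf_maps S X Z"
proof -
  have "compose (snd A) (compose (points X) h g) p = compose (snd A) h (compose (snd A) g p)"
    if "A \<in> objects S" "p \<in> sections X A" for A p
    using compose_assoc[of p "snd A" "points X" h g] concrete_sheafD(1)[OF assms(1) that]
    by (simp add: PiE_iff Pi_iff)
  then have "compose (snd A) (compose (points X) h g) p \<in> sections Z A"
    if "A \<in> objects S" "p \<in> sections X A" for A p
    using that assms(2,3) by (simp add: sheaf_mapsD(2))
  moreover have "compose (points X) h g \<in> points X \<rightarrow>\<^sub>E points Z"
    using sheaf_mapsD(1)[OF assms(2)] sheaf_mapsD(1)[OF assms(3)] by (auto simp: compose_def)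
  ultimately show ?thesis by (simp add: sheaf_maps_def)
qed

section \<open>Colimits of diffeological spaces\<close>

lemma points_colim:
  "points (colim J D0 D1) = {colim_class J D0 D1 (i, x) | i x. i \<in> Ob J \<and> x \<in> points (D0 i)}"
  by (auto simp: colim_def Let_def)

lemma sections_colim:
  "sections (colim J D0 D1) A =
     {\<phi> \<in> snd A \<rightarrow>\<^sub>E points (colim J D0 D1).
       \<forall>w\<in>snd A. \<exists>W'\<subseteq>snd A. openin (Euclidean_space (fst A)) W' \<and> w \<in> W' \<and>
         (\<exists>i\<in>Ob J. \<exists>\<psi>\<in>sections (D0 i) (fst A, W').
            restrict \<phi> W' = compose W' (colim_leg J D0 D1 i) \<psi>)}"
  by (cases A) (auto simp: colim_def Let_def)

text \<open>
  The reflexive transitive closure of a symmetric relation is an equivalence relation on the whole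
  type, whose classes these are.
\<close>
lemma colim_class_eq_iff:
  "colim_class J D0 D1 z = colim_class J D0 D1 z' \<longleftrightarrow>
     (z, z') \<in> (colim_step J D0 D1 \<union> (colim_step J D0 D1)\<inverse>)\<^sup>*"
proof -
  let ?R = "(colim_step J D0 D1 \<union> (colim_step J D0 D1)\<inverse>)\<^sup>*"
  have "sym ?R" by (intro sym_rtrancl) (auto simp: sym_def)
  then have "equiv UNIV ?R"
    by (intro equivI) (auto simp: refl_rtrancl trans_rtrancl)
  then show ?thesis
    unfolding colim_class_def by (simp add: eq_equiv_class_iff)
qed

lemma is_functor_diffD:
  assumes "is_functor J diff_cat D0 D1"
  shows "i \<in> Ob J \<Longrightarrow> is_diff_space (D0 i)"
    and "i \<in> Ob J \<Longrightarrow> j \<in> Ob J \<Longrightarrow> f \<in> Hom J i j \<Longrightarrow> D1 i j f \<in> smooth_maps (D0 i) (D0 j)"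
  using assms by (auto simp: is_functor_def diff_cat_def)

lemma colim_leg_in:
  "i \<in> Ob J \<Longrightarrow> colim_leg J D0 D1 i \<in> points (D0 i) \<rightarrow>\<^sub>E points (colim J D0 D1)"
  by (auto simp: colim_leg_def points_colim)

text \<open>
  With a global lift, the whole domain serves as the neighbourhood that is asked for at each point.
\<close>
lemma colim_sectionI:
  assumes "A \<in> objects smooth_site" "i \<in> Ob J" "is_diff_space (D0 i)" "\<psi> \<in> sections (D0 i) A"
  shows "compose (snd A) (colim_leg J D0 D1 i) \<psi> \<in> sections (colim J D0 D1) A"
proof -
  have "\<psi> \<in> snd A \<rightarrow>\<^sub>E points (D0 i)"
    using concrete_sheafD(1)[OF assms(3,1,4)] .
  then have "compose (snd A) (colim_leg J D0 D1 i) \<psi> \<in> snd A \<rightarrow>\<^sub>E points (colim J D0 D1)"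
    using colim_leg_in[OF assms(2), of D0 D1] by (auto simp: compose_def PiE_iff)
  then show ?thesis
    using assms(1,2,4) unfolding sections_colim mem_objects_smooth
    by (auto simp: restrict_def compose_def fun_eq_iff intro!: exI[of _ "snd A"] bexI[of _ i] bexI[of _ \<psi>])
qed

text \<open>
  Constant functions lift through a leg by joint surjectivity of the legs; a local lift is pulled
  back along a morphism by precomposing it with the restriction to the preimage of its domain; and
  the sheaf condition holds because being a plot is a local condition by definition.
\<close>
lemma colim_is_diff_space:
  assumes F: "is_functor J diff_cat D0 D1"
  shows "is_diff_space (colim J D0 D1)"
  unfolding concrete_sheaf_def
proof (intro conjI ballI impI)
  show "sections (colim J D0 D1) A \<subseteq> snd A \<rightarrow>\<^sub>E points (colim J D0 D1)" for A
    by (auto simp: sections_colim)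
next
  fix A c assume A: "A \<in> objects smooth_site" and "c \<in> points (colim J D0 D1)"
  then obtain i x where i: "i \<in> Ob J" "x \<in> points (D0 i)" "c = colim_class J D0 D1 (i, x)"
    by (auto simp: points_colim)
  note D = is_functor_diffD(1)[OF F i(1)]
  have "compose (snd A) (colim_leg J D0 D1 i) (\<lambda>a\<in>snd A. x) \<in> sections (colim J D0 D1) A"
    by (rule colim_sectionI[where ?D0.0 = D0, OF A i(1) D concrete_sheafD(2)[OF D A i(2)]])
  also have "compose (snd A) (colim_leg J D0 D1 i) (\<lambda>a\<in>snd A. x) = (\<lambda>a\<in>snd A. c)"
    using i by (auto simp: compose_def colim_leg_def fun_eq_iff)
  finally show "(\<lambda>a\<in>snd A. c) \<in> sections (colim J D0 D1) A" .
next
  fix A B f \<phi>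
  assume A: "A \<in> objects smooth_site" and B: "B \<in> objects smooth_site"
    and f: "f \<in> mors smooth_site A B" and \<phi>: "\<phi> \<in> sections (colim J D0 D1) B"
  have fAB: "f \<in> snd A \<rightarrow>\<^sub>E snd B" using f by (simp add: mem_mors_smooth)
  have "\<exists>W'\<subseteq>snd A. openin (Euclidean_space (fst A)) W' \<and> w \<in> W' \<and>
         (\<exists>i\<in>Ob J. \<exists>\<psi>\<in>sections (D0 i) (fst A, W').
            restrict (compose (snd A) \<phi> f) W' = compose W' (colim_leg J D0 D1 i) \<psi>)"
    if w: "w \<in> snd A" for w
  proof -
    have "f w \<in> snd B" using fAB w by auto
    then obtain W i \<psi> where W: "W \<subseteq> snd B" "openin (Euclidean_space (fst B)) W" "f w \<in> W"
      and i: "i \<in> Ob J" and \<psi>: "\<psi> \<in> sections (D0 i) (fst B, W)"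
      and eq: "restrict \<phi> W = compose W (colim_leg J D0 D1 i) \<psi>"
      using \<phi> by (fastforce simp: sections_colim)
    define W' where "W' = {x \<in> snd A. f x \<in> W}"
    have W': "openin (Euclidean_space (fst A)) W'"
      unfolding W'_def by (rule smooth_site_preimage[OF A B f W(2)])
    have "restrict f W' \<in> mors smooth_site (fst A, W') B"
      using smooth_site_restrict[OF A, of "(fst A, W')"] W' f by (auto simp: W'_def)
    then have f': "restrict f W' \<in> mors smooth_site (fst A, W') (fst B, W)"
      by (auto simp: mem_mors_smooth W'_def PiE_iff)
    have "compose W' \<psi> (restrict f W') \<in> sections (D0 i) (fst A, W')"
      using concrete_sheafD(3)[OF is_functor_diffD(1)[OF F i], of "(fst A, W')" "(fst B, W)"]
        f' \<psi> W' W(2) by (simp add: mem_objects_smooth)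
    moreover have "restrict (compose (snd A) \<phi> f) W' =
        compose W' (colim_leg J D0 D1 i) (compose W' \<psi> (restrict f W'))"
    proof
      fix x
      show "restrict (compose (snd A) \<phi> f) W' x =
        compose W' (colim_leg J D0 D1 i) (compose W' \<psi> (restrict f W')) x"
        using fun_cong[OF eq, of "f x"] by (auto simp: compose_def W'_def)
    qed
    ultimately show ?thesis
      using W' W(3) w i by (intro exI[of _ W']) (auto simp: W'_def)
  qed
  moreover have "compose (snd A) \<phi> f \<in> snd A \<rightarrow>\<^sub>E points (colim J D0 D1)"
    using fAB \<phi> by (auto simp: sections_colim compose_def PiE_iff)
  ultimately show "compose (snd A) \<phi> f \<in> sections (colim J D0 D1) A"
    by (simp add: sections_colim)
next
  fix A \<C> \<phi>
  assume A: "A \<in> objects smooth_site" and \<C>: "\<C> \<in> covers smooth_site A"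
    and \<phi>: "\<phi> \<in> snd A \<rightarrow>\<^sub>E points (colim J D0 D1)"
    and loc: "\<forall>B\<in>\<C>. restrict \<phi> (snd B) \<in> sections (colim J D0 D1) B"
  have "\<exists>W'\<subseteq>snd A. openin (Euclidean_space (fst A)) W' \<and> w \<in> W' \<and>
         (\<exists>i\<in>Ob J. \<exists>\<psi>\<in>sections (D0 i) (fst A, W').
            restrict \<phi> W' = compose W' (colim_leg J D0 D1 i) \<psi>)"
    if w: "w \<in> snd A" for w
  proof -
    obtain B where B: "B \<in> \<C>" "w \<in> snd B" "fst B = fst A" "snd B \<subseteq> snd A"
      using smooth_site_coverE[OF A \<C> w] by metis
    from B(1) loc have "restrict \<phi> (snd B) \<in> sections (colim J D0 D1) B" by blast
    then obtain W i \<psi> where W: "W \<subseteq> snd B" "openin (Euclidean_space (fst B)) W" "w \<in> W"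
      and i: "i \<in> Ob J" and \<psi>: "\<psi> \<in> sections (D0 i) (fst B, W)"
      and eq: "restrict (restrict \<phi> (snd B)) W = compose W (colim_leg J D0 D1 i) \<psi>"
      using B(2) by (fastforce simp: sections_colim)
    then show ?thesis
      using B by (intro exI[of _ W]) (auto simp: Int_absorb1)
  qed
  then show "\<phi> \<in> sections (colim J D0 D1) A"
    using \<phi> by (simp add: sections_colim)
qed

lemma colim_is_cocone:
  assumes F: "is_functor J diff_cat D0 D1"
  shows "is_cocone J D0 D1 (colim J D0 D1) (colim_leg J D0 D1)"
  unfolding is_cocone_def
proof (intro conjI ballI)
  fix i assume i: "i \<in> Ob J"
  show "colim_leg J D0 D1 i \<in> smooth_maps (D0 i) (colim J D0 D1)"
    unfolding sheaf_maps_def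
  proof (intro CollectI conjI ballI)
    show "colim_leg J D0 D1 i \<in> points (D0 i) \<rightarrow>\<^sub>E points (colim J D0 D1)"
      by (rule colim_leg_in[OF i])
    show "compose (snd A) (colim_leg J D0 D1 i) \<psi> \<in> sections (colim J D0 D1) A"
      if "A \<in> objects smooth_site" "\<psi> \<in> sections (D0 i) A" for A \<psi>
      using that(1) i is_functor_diffD(1)[OF F i] that(2) by (rule colim_sectionI)
  qed
next
  fix i j f assume ij: "i \<in> Ob J" "j \<in> Ob J" "f \<in> Hom J i j"
  have D1: "D1 i j f \<in> points (D0 i) \<rightarrow>\<^sub>E points (D0 j)"
    using sheaf_mapsD(1)[OF is_functor_diffD(2)[OF F ij]] .
  have "colim_class J D0 D1 (i, x) = colim_class J D0 D1 (j, D1 i j f x)" if "x \<in> points (D0 i)" for x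
  proof -
    have "((i, x), (j, D1 i j f x)) \<in> colim_step J D0 D1"
      using ij that by (auto simp: colim_step_def)
    then show ?thesis by (auto simp: colim_class_eq_iff)
  qed
  then show "compose (points (D0 i)) (colim_leg J D0 D1 j) (D1 i j f) = colim_leg J D0 D1 i"
    using D1 by (auto simp: compose_def colim_leg_def restrict_def fun_eq_iff)
qed

text \<open>
  The legs are jointly surjective, which leaves no freedom for a mediating map.
\<close>
lemma colim_mediating_unique:
  assumes u: "u \<in> mediating_maps J D0 D1 (colim J D0 D1) (colim_leg J D0 D1) T h"
    and v: "v \<in> mediating_maps J D0 D1 (colim J D0 D1) (colim_leg J D0 D1) T h"
  shows "u = v"
proof (rule PiE_ext)
  show "u \<in> points (colim J D0 D1) \<rightarrow>\<^sub>E points T" "v \<in> points (colim J D0 D1) \<rightarrow>\<^sub>E points T"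
    using u v by (auto simp: mediating_maps_def dest: sheaf_mapsD(1))
next
  fix c assume "c \<in> points (colim J D0 D1)"
  then obtain i x where i: "i \<in> Ob J" "x \<in> points (D0 i)" "c = colim_class J D0 D1 (i, x)"
    by (auto simp: points_colim)
  then have c: "c = colim_leg J D0 D1 i x" by (simp add: colim_leg_def)
  have "compose (points (D0 i)) u (colim_leg J D0 D1 i) = compose (points (D0 i)) v (colim_leg J D0 D1 i)"
    using u v i(1) by (auto simp: mediating_maps_def)
  from fun_cong[OF this, of x] show "u c = v c"
    using i(2) by (simp add: compose_eq c)
qed

text \<open>
  The cocone h is constant along the generating steps and thus on classes, so it descends to a
  function u on the quotient. A plot of the colimit locally has the form \<open>leg i \<circ> \<psi>\<close>, where u turns it
  into \<open>h i \<circ> \<psi>\<close>, a plot of T; the open sets on which this happens cover the domain, and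
  the sheaf condition of T glues.
\<close>
lemma colim_mediating_exists:
  assumes F: "is_functor J diff_cat D0 D1"
    and T: "is_diff_space T" and h: "is_cocone J D0 D1 T h"
  shows "\<exists>u. u \<in> mediating_maps J D0 D1 (colim J D0 D1) (colim_leg J D0 D1) T h"
proof -
  let ?Q = "points (colim J D0 D1)"
  have h_in: "h i \<in> smooth_maps (D0 i) T" if "i \<in> Ob J" for i
    using h that by (simp add: is_cocone_def)
  have step: "h (fst z) (snd z) = h (fst z') (snd z')" if zz: "(z, z') \<in> colim_step J D0 D1" for z z'
  proof -
    obtain i j f x where z: "z = (i, x)" "z' = (j, D1 i j f x)"
      and ij: "i \<in> Ob J" "j \<in> Ob J" "f \<in> Hom J i j" and x: "x \<in> points (D0 i)"
      using zz by (auto simp: colim_step_def)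
    have "compose (points (D0 i)) (h j) (D1 i j f) = h i"
      using h ij by (simp add: is_cocone_def)
    from fun_cong[OF this, of x] show ?thesis using x by (simp add: z compose_eq)
  qed
  have inv: "h (fst z) (snd z) = h (fst z') (snd z')"
    if "colim_class J D0 D1 z = colim_class J D0 D1 z'" for z z'
    using that unfolding colim_class_eq_iff
    by (induction rule: rtrancl_induct) (auto dest: step)
  define u where "u = (\<lambda>c\<in>?Q. let z = (SOME z. c = colim_class J D0 D1 z) in h (fst z) (snd z))"
  have u: "u (colim_class J D0 D1 (i, x)) = h i x" if "i \<in> Ob J" "x \<in> points (D0 i)" for i x
  proof -
    let ?c = "colim_class J D0 D1 (i, x)"
    have "?c = colim_class J D0 D1 (SOME z. ?c = colim_class J D0 D1 z)"
      by (rule someI[of _ "(i, x)"]) simp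
    from inv[OF this] show ?thesis
      using that by (auto simp: u_def Let_def points_colim)
  qed
  have comm: "compose (points (D0 i)) u (colim_leg J D0 D1 i) = h i" if i: "i \<in> Ob J" for i
  proof (rule extensionalityI)
    show "h i \<in> extensional (points (D0 i))"
      using sheaf_mapsD(1)[OF h_in[OF i]] by (simp add: PiE_iff)
  qed (use i in \<open>auto simp: compose_eq colim_leg_def u compose_extensional\<close>)
  have uQ: "u \<in> ?Q \<rightarrow>\<^sub>E points T"
  proof (rule PiE_I)
    fix c assume "c \<in> ?Q"
    then obtain i x where i: "i \<in> Ob J" "x \<in> points (D0 i)" "c = colim_class J D0 D1 (i, x)"
      by (auto simp: points_colim)
    then show "u c \<in> points T" using u sheaf_mapsD(1)[OF h_in[OF i(1)]] by auto
  qed (simp add: u_def)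
  have "u \<in> smooth_maps (colim J D0 D1) T"
    unfolding sheaf_maps_def
  proof (intro CollectI conjI ballI uQ)
    fix A \<phi> assume A: "A \<in> objects smooth_site" and \<phi>: "\<phi> \<in> sections (colim J D0 D1) A"
    define \<C> where "\<C> = {(fst A, W) | W. W \<subseteq> snd A \<and> openin (Euclidean_space (fst A)) W \<and>
         (\<exists>i\<in>Ob J. \<exists>\<psi>\<in>sections (D0 i) (fst A, W).
            restrict \<phi> W = compose W (colim_leg J D0 D1 i) \<psi>)}"
    have "\<C> \<in> covers smooth_site A"
    proof -
      have "snd A \<subseteq> (\<Union>B\<in>\<C>. snd B)"
      proof
        fix w assume "w \<in> snd A"
        then have "\<exists>W\<subseteq>snd A. openin (Euclidean_space (fst A)) W \<and> w \<in> W \<and>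
            (\<exists>i\<in>Ob J. \<exists>\<psi>\<in>sections (D0 i) (fst A, W).
               restrict \<phi> W = compose W (colim_leg J D0 D1 i) \<psi>)"
          using \<phi> by (simp add: sections_colim)
        then obtain W where "w \<in> W" "(fst A, W) \<in> \<C>"
          unfolding \<C>_def by auto
        then show "w \<in> (\<Union>B\<in>\<C>. snd B)" by force
      qed
      then show ?thesis
        using A by (auto simp: covers_smooth open_covers_def mem_objects_smooth \<C>_def
            openin_open_subtopology)
    qed
    then show "compose (snd A) u \<phi> \<in> sections T A"
    proof (rule concrete_sheafD(4)[OF T A])
      show "compose (snd A) u \<phi> \<in> snd A \<rightarrow>\<^sub>E points T"
        using \<phi> uQ by (auto simp: sections_colim compose_def PiE_iff)
      fix B assume "B \<in> \<C>"
      then obtain W i \<psi> where B: "B = (fst A, W)" and W: "W \<subseteq> snd A" "openin (Euclidean_space (fst A)) W"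
        and i: "i \<in> Ob J" and \<psi>: "\<psi> \<in> sections (D0 i) (fst A, W)"
        and eq: "restrict \<phi> W = compose W (colim_leg J D0 D1 i) \<psi>"
        unfolding \<C>_def by blast
      have W': "(fst A, W) \<in> objects smooth_site" using W by (simp add: mem_objects_smooth)
      have \<psi>W: "\<psi> \<in> W \<rightarrow>\<^sub>E points (D0 i)"
        using concrete_sheafD(1)[OF is_functor_diffD(1)[OF F i] W' \<psi>] by simp
      have "restrict (compose (snd A) u \<phi>) W = compose W (h i) \<psi>"
      proof
        fix x
        show "restrict (compose (snd A) u \<phi>) W x = compose W (h i) \<psi> x"
          using fun_cong[OF eq, of x] fun_cong[OF comm[OF i], of "\<psi> x"] W(1) \<psi>W
          by (auto simp: compose_def split: if_splits)
      qed
      moreover have "compose W (h i) \<psi> \<in> sections T (fst A, W)"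
        using sheaf_mapsD(2)[OF h_in[OF i] W' \<psi>] by simp
      ultimately show "restrict (compose (snd A) u \<phi>) (snd B) \<in> sections T B"
        by (simp add: B)
    qed
  qed
  with comm show ?thesis by (auto simp: mediating_maps_def)
qed

lemma colim_universal:
  assumes "is_functor J diff_cat D0 D1" "is_diff_space T" "is_cocone J D0 D1 T h"
  shows "\<exists>!u. u \<in> mediating_maps J D0 D1 (colim J D0 D1) (colim_leg J D0 D1) T h"
  using colim_mediating_exists[OF assms] colim_mediating_unique by blast

lemma colim_desc_mediating:
  assumes "is_functor J diff_cat D0 D1" "is_diff_space T" "is_cocone J D0 D1 T h"
  shows "colim_desc J D0 D1 T h \<in> mediating_maps J D0 D1 (colim J D0 D1) (colim_leg J D0 D1) T h"
  unfolding colim_desc_def by (rule theI'[OF colim_universal[OF assms]])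

lemma colim_desc_eqI:
  assumes "u \<in> mediating_maps J D0 D1 (colim J D0 D1) (colim_leg J D0 D1) T h"
  shows "colim_desc J D0 D1 T h = u"
  unfolding colim_desc_def
proof (rule the_equality)
  show "u \<in> mediating_maps J D0 D1 (colim J D0 D1) (colim_leg J D0 D1) T h"
    by (rule assms)
qed (rule colim_mediating_unique[where ?D0.0 = D0 and T = T and h = h, OF _ assms])

section \<open>Standard parts of quasi-standard smooth maps\<close>

lemma mem_mors_fermat:
  "f \<in> mors fermat_site A B \<longleftrightarrow>
     f \<in> snd A \<rightarrow>\<^sub>E snd B \<and> quasi_standard_smooth (fst A) (snd A) (fst B) f"
  by (cases A; cases B) (simp add: fermat_site_def)

lemma ext_obj_fermat: "ext_obj A \<in> objects fermat_site"
  by (auto simp: fermat_site_def ext_obj_def fermat_ext_set_def)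

lemma ext_obj_simps [simp]:
  "fst (ext_obj A) = fst A" "snd (ext_obj A) = fermat_ext_set (fst A) (snd A)"
  by (simp_all add: ext_obj_def)

lemma little_oh_poly_const: "u \<in> eucl n \<Longrightarrow> little_oh_poly n (\<lambda>t. u)"
  unfolding little_oh_poly_def
  by (intro conjI exI[of _ 1] bexI[of _ u] exI[of _ "0::nat"])
    (auto simp: vnorm_def L2_set_def)

lemma fermat_rel_refl: "little_oh_poly n x \<Longrightarrow> (x, x) \<in> fermat_rel n"
  by (simp add: fermat_rel_def vnorm_def L2_set_def)

lemma fermat_rel_initial: "(x, y) \<in> fermat_rel n \<Longrightarrow> x 0 = y 0"
  by (simp add: fermat_rel_def)

lemma fermat_eucl_nonempty: "c \<in> fermat_eucl n \<Longrightarrow> \<exists>x. x \<in> c"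
  by (auto simp: fermat_eucl_def quotient_def intro: fermat_rel_refl)

text \<open>
  Related little-oh polynomials have the same value at 0, so any representative computes the
  standard part.
\<close>
lemma std_part_eq:
  assumes "c \<in> fermat_eucl n" "x \<in> c"
  shows "std_part c = x 0"
proof -
  obtain z where "c = fermat_rel n `` {z}"
    using assms(1) by (auto simp: fermat_eucl_def quotient_def)
  then have "y 0 = x 0" if "y \<in> c" for y
    using that assms(2) fermat_rel_initial by (metis Image_singleton_iff)
  then have "(\<lambda>y. y 0) ` c = (\<lambda>y. x 0) ` c"
    by (intro image_cong refl)
  also have "\<dots> = {x 0}"
    using assms(2) by (rule image_constant)
  finally show ?thesis by (simp add: std_part_def)
qed

lemma const_point_fermat_eucl: "u \<in> eucl n \<Longrightarrow> const_point n u \<in> fermat_eucl n"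
  by (auto simp: const_point_def fermat_eucl_def intro!: quotientI little_oh_poly_const)

lemma std_part_const_point: "u \<in> eucl n \<Longrightarrow> std_part (const_point n u) = u"
  using std_part_eq[OF const_point_fermat_eucl, of u n "\<lambda>t. u"]
  by (simp add: const_point_def fermat_rel_refl little_oh_poly_const)

lemma const_point_in_ext:
  "openin (Euclidean_space n) U \<Longrightarrow> u \<in> U \<Longrightarrow> const_point n u \<in> fermat_ext_set n U"
  by (auto simp: fermat_ext_set_def std_part_const_point const_point_fermat_eucl
      dest: openin_Euclidean_subset)

text \<open>
  As the value is a Fermat point, it has a representative. By construction this representative is
  related to the composite of \<open>\<alpha>\<close> with a representative of the pair, which starts where the
  representatives of p and c start; evaluation at 0 gives the claim.
\<close>
lemma std_part_ext_map_pair: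
  assumes "p \<in> fermat_eucl k" "c \<in> fermat_eucl n"
    and "fermat_ext_map m \<alpha> (fermat_pair k n p c) \<in> fermat_eucl m"
  shows "std_part (fermat_ext_map m \<alpha> (fermat_pair k n p c)) =
         \<alpha> (vappend k (std_part p) (std_part c))"
proof -
  obtain y where y: "y \<in> fermat_ext_map m \<alpha> (fermat_pair k n p c)"
    using fermat_eucl_nonempty[OF assms(3)] by blast
  then obtain a b z where "a \<in> p" "b \<in> c"
    and z: "((\<lambda>t. vappend k (a t) (b t)), z) \<in> fermat_rel (k + n)" "(\<alpha> \<circ> z, y) \<in> fermat_rel m"
    by (auto simp: fermat_ext_map_def fermat_pair_def)
  then have "std_part p = a 0" "std_part c = b 0"
    using assms(1,2) by (auto intro: std_part_eq)
  moreover have "y 0 = \<alpha> (vappend k (a 0) (b 0))"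
    using z[THEN fermat_rel_initial] by simp
  ultimately show ?thesis using std_part_eq[OF assms(3) y] by simp
qed

text \<open>
  Near c, the standard part of \<open>f c'\<close> is a smooth function \<open>\<beta>\<close> of the standard part of \<open>c'\<close>
  alone: if \<open>\<alpha>\<close> and p represent f near c, then \<open>\<beta>\<close> is the slice of \<open>\<alpha>\<close> at the standard part of p.
\<close>
lemma std_part_locally_smooth:
  assumes A: "A \<in> objects smooth_site" and f: "f \<in> mors fermat_site (ext_obj A) (ext_obj B)"
    and c: "c \<in> fermat_ext_set (fst A) (snd A)"
  obtains U \<beta> where "openin (Euclidean_space (fst A)) U" "std_part c \<in> U" "U \<subseteq> snd A"
    "smooth_on (fst A) U (fst B) \<beta>"
    "\<And>c'. c' \<in> fermat_ext_set (fst A) U \<Longrightarrow> std_part (f c') = \<beta> (std_part c')"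
proof -
  let ?n = "fst A" and ?m = "fst B"
  have fAB: "f \<in> fermat_ext_set ?n (snd A) \<rightarrow> fermat_ext_set ?m (snd B)"
    and qss: "quasi_standard_smooth ?n (fermat_ext_set ?n (snd A)) ?m f"
    using f by (auto simp: mem_mors_fermat)
  from bspec[OF qss[unfolded quasi_standard_smooth_def] c]
  obtain U k P \<alpha> p where U: "openin (Euclidean_space ?n) U" "std_part c \<in> U"
    and P: "openin (Euclidean_space k) P" and \<alpha>: "smooth_on (k + ?n) (vprod k P U) ?m \<alpha>"
    and p: "p \<in> fermat_ext_set k P"
    and eq: "\<forall>c \<in> fermat_ext_set ?n (snd A) \<inter> fermat_ext_set ?n U.
      f c = fermat_ext_map ?m \<alpha> (fermat_pair k ?n p c)"
    by (elim exE conjE) (rule that; assumption)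
  show thesis
  proof
    show "openin (Euclidean_space ?n) (U \<inter> snd A)"
      using A U(1) by (auto simp: mem_objects_smooth)
    show "std_part c \<in> U \<inter> snd A" using c U(2) by (simp add: fermat_ext_set_def)
    show "smooth_on ?n (U \<inter> snd A) ?m (\<lambda>u. \<alpha> (vappend k (std_part p) u))"
      by (rule smooth_on_subset[OF smooth_on_slice[OF P _ U(1) \<alpha>]])
        (use p in \<open>auto simp: fermat_ext_set_def\<close>)
    fix c' assume "c' \<in> fermat_ext_set ?n (U \<inter> snd A)"
    then have c': "c' \<in> fermat_ext_set ?n (snd A)" "c' \<in> fermat_ext_set ?n U"
      by (auto simp: fermat_ext_set_def)
    then have fc': "f c' = fermat_ext_map ?m \<alpha> (fermat_pair k ?n p c')"
      using eq by blast
    moreover have "f c' \<in> fermat_eucl ?m"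
      using fAB c'(1) by (auto simp: fermat_ext_set_def)
    ultimately show "std_part (f c') = \<alpha> (vappend k (std_part p) (std_part c'))"
      using std_part_ext_map_pair[of p k c' ?n ?m \<alpha>] p c'(1) by (simp add: fermat_ext_set_def)
  qed simp
qed

lemma points_base_space [simp]: "points (base_space P) = snd (fst P)"
  by (simp add: base_space_def representable_def)

lemma base_map_apply:
  "u \<in> snd (fst P) \<Longrightarrow> base_map P Q f u = std_part (f (const_point (fst (fst P)) u))"
  by (simp add: base_map_def)

text \<open>
  Standard parts intertwine f with its base map: c and the constant point at its standard part
  lie over the same point, so the local formula gives the same value for both. This is the reason why
  taking base maps respects composition.
\<close>
lemma base_map_std_part:
  assumes A: "fst P \<in> objects smooth_site"
    and f: "f \<in> mors fermat_site (ext_obj (fst P)) (ext_obj (fst Q))"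
    and c: "c \<in> fermat_ext_set (fst (fst P)) (snd (fst P))"
  shows "std_part (f c) = base_map P Q f (std_part c)"
proof -
  obtain U \<beta> where U: "openin (Euclidean_space (fst (fst P))) U" "std_part c \<in> U" "U \<subseteq> snd (fst P)"
    and \<beta>: "\<And>c'. c' \<in> fermat_ext_set (fst (fst P)) U \<Longrightarrow> std_part (f c') = \<beta> (std_part c')"
    using std_part_locally_smooth[OF A f c] by metis
  have "std_part c \<in> eucl (fst (fst P))"
    using U(1,2) by (rule openin_Euclidean_subset)
  moreover have "c \<in> fermat_ext_set (fst (fst P)) U"
    using c U(2) by (simp add: fermat_ext_set_def)
  moreover have "const_point (fst (fst P)) (std_part c) \<in> fermat_ext_set (fst (fst P)) U"
    by (rule const_point_in_ext[OF U(1,2)])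
  ultimately show ?thesis
    using \<beta> U(2,3) by (simp add: base_map_apply std_part_const_point subset_iff)
qed

lemma base_map_mors:
  assumes A: "fst P \<in> objects smooth_site"
    and f: "f \<in> mors fermat_site (ext_obj (fst P)) (ext_obj (fst Q))"
  shows "base_map P Q f \<in> mors smooth_site (fst P) (fst Q)"
proof -
  have open_A: "openin (Euclidean_space (fst (fst P))) (snd (fst P))"
    using A by (simp add: mem_objects_smooth)
  have "smooth_on (fst (fst P)) (snd (fst P)) (fst (fst Q)) (base_map P Q f)"
  proof (rule smooth_on_local[OF open_A])
    fix u assume u: "u \<in> snd (fst P)"
    have c: "const_point (fst (fst P)) v \<in> fermat_ext_set (fst (fst P)) U"
      and std: "std_part (const_point (fst (fst P)) v) = v"
      if "openin (Euclidean_space (fst (fst P))) U" "v \<in> U" for U v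
      using const_point_in_ext[OF that] std_part_const_point[OF openin_Euclidean_subset[OF that]]
      by auto
    obtain U \<beta> where U: "openin (Euclidean_space (fst (fst P))) U" "u \<in> U" "U \<subseteq> snd (fst P)"
      and \<beta>: "smooth_on (fst (fst P)) U (fst (fst Q)) \<beta>"
        "\<And>c'. c' \<in> fermat_ext_set (fst (fst P)) U \<Longrightarrow> std_part (f c') = \<beta> (std_part c')"
      using std_part_locally_smooth[OF A f c[OF open_A u]] unfolding std[OF open_A u] by metis
    have "base_map P Q f v = \<beta> v" if "v \<in> U" for v
      using \<beta>(2)[OF c[OF U(1) that]] that U(3) by (simp add: base_map_apply std[OF U(1) that] subset_iff)
    then have "smooth_on (fst (fst P)) U (fst (fst Q)) (base_map P Q f)"
      using \<beta>(1) smooth_on_cong[OF U(1)] by blast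
    with U show "\<exists>U\<subseteq>snd (fst P). openin (Euclidean_space (fst (fst P))) U \<and> u \<in> U \<and>
        smooth_on (fst (fst P)) U (fst (fst Q)) (base_map P Q f)"
      by blast
  qed
  moreover have "base_map P Q f u \<in> snd (fst Q)" if "u \<in> snd (fst P)" for u
    using f const_point_in_ext[OF open_A that] that
    by (auto simp: base_map_apply mem_mors_fermat fermat_ext_set_def)
  ultimately show ?thesis
    by (auto simp: mem_mors_smooth base_map_def)
qed

section \<open>The diagram and its functoriality in the Fermat space\<close>

lemma Ob_plots_over:
  "P \<in> Ob (plots_over X) \<longleftrightarrow> fst P \<in> objects smooth_site \<and> snd P \<in> sections X (ext_obj (fst P))"
  by (cases P) (simp add: plots_over_def)

lemma Hom_plots_over:
  "f \<in> Hom (plots_over X) P Q \<longleftrightarrow>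
     f \<in> mors fermat_site (ext_obj (fst P)) (ext_obj (fst Q)) \<and>
     compose (snd (ext_obj (fst P))) (snd Q) f = snd P"
  by (cases P; cases Q) (simp add: plots_over_def)

lemma base_functor: "is_functor (plots_over X) diff_cat base_space base_map"
  unfolding is_functor_def
proof (intro conjI ballI)
  fix P assume P: "P \<in> Ob (plots_over X)"
  then show "base_space P \<in> Ob diff_cat"
    by (simp add: diff_cat_def base_space_def Ob_plots_over representable_is_diff_space)
  have "std_part (const_point (fst (fst P)) u) = u" "const_point (fst (fst P)) u \<in> fermat_ext_set (fst (fst P)) (snd (fst P))"
    if "u \<in> snd (fst P)" for u
    using P that by (auto simp: Ob_plots_over mem_objects_smooth
      intro: std_part_const_point const_point_in_ext openin_Euclidean_subset)
  then show "base_map P P (Ident (plots_over X) P) = Ident diff_cat (base_space P)"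
    by (cases P) (auto simp: base_map_def plots_over_def diff_cat_def fun_eq_iff)
next
  fix P Q f assume "P \<in> Ob (plots_over X)" "Q \<in> Ob (plots_over X)" "f \<in> Hom (plots_over X) P Q"
  then show "base_map P Q f \<in> Hom diff_cat (base_space P) (base_space Q)"
    by (simp add: diff_cat_def base_space_def Ob_plots_over Hom_plots_over mors_are_smooth_maps base_map_mors)
next
  fix P Q R f g
  assume P: "P \<in> Ob (plots_over X)" "Q \<in> Ob (plots_over X)" "R \<in> Ob (plots_over X)"
    and f: "f \<in> Hom (plots_over X) P Q" and g: "g \<in> Hom (plots_over X) Q R"
  have "std_part (g (f (const_point (fst (fst P)) u))) = base_map Q R g (base_map P Q f u)"
    and "const_point (fst (fst P)) u \<in> fermat_ext_set (fst (fst P)) (snd (fst P))"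
    if u: "u \<in> snd (fst P)" for u
  proof -
    show c: "const_point (fst (fst P)) u \<in> fermat_ext_set (fst (fst P)) (snd (fst P))"
      using P(1) u by (simp add: Ob_plots_over mem_objects_smooth const_point_in_ext)
    then have "f (const_point (fst (fst P)) u) \<in> fermat_ext_set (fst (fst Q)) (snd (fst Q))"
      using f by (auto simp: Hom_plots_over mem_mors_fermat)
    then show "std_part (g (f (const_point (fst (fst P)) u))) = base_map Q R g (base_map P Q f u)"
      using P(2) g u base_map_std_part[of Q g R] by (simp add: Ob_plots_over Hom_plots_over base_map_apply)
  qed
  then show "base_map P R (Comp (plots_over X) P Q R g f) =
      Comp diff_cat (base_space P) (base_space Q) (base_space R) (base_map Q R g) (base_map P Q f)"
    by (cases P) (auto simp: base_map_def[of P R] base_map_def[of "(a, b)" R for a b] plots_over_def diff_cat_def compose_def fun_eq_iff)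
qed

lemma del_is_diff_space: "is_diff_space (del X)"
  unfolding del_def by (rule colim_is_diff_space[OF base_functor])

lemma del_is_cocone: "is_cocone (plots_over X) base_space base_map (del X) (del_leg X)"
  unfolding del_def del_leg_def by (rule colim_is_cocone[OF base_functor])

lemma push_plot_simps [simp]:
  "fst (push_plot g P) = fst P"
  "snd (push_plot g P) = compose (snd (ext_obj (fst P))) g (snd P)"
  "base_space (push_plot g P) = base_space P"
  "base_map (push_plot g P) (push_plot g Q) = base_map P Q"
  by (simp_all add: push_plot_def base_space_def base_map_def fun_eq_iff split_beta)

lemma push_plot_Ob:
  "g \<in> fermat_maps X Y \<Longrightarrow> P \<in> Ob (plots_over X) \<Longrightarrow> push_plot g P \<in> Ob (plots_over Y)"
  using sheaf_mapsD(2)[OF _ ext_obj_fermat, of g X Y "snd P" "fst P"] by (simp add: Ob_plots_over)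

text \<open>
  With \<open>push_plot_simps\<close> this makes pushing forward a functor over the diagram: it changes the
  plots but neither their domains nor the maps between these.
\<close>
lemma push_plot_Hom:
  assumes "f \<in> Hom (plots_over X) P Q"
  shows "f \<in> Hom (plots_over Y) (push_plot g P) (push_plot g Q)"
proof -
  have "f \<in> snd (ext_obj (fst P)) \<rightarrow> snd (ext_obj (fst Q))"
    using assms by (auto simp: Hom_plots_over mem_mors_fermat)
  from compose_assoc[OF this, of g "snd Q"] show ?thesis
    using assms by (simp add: Hom_plots_over)
qed

lemma plot_in:
  assumes "is_fermat_space X" "P \<in> Ob (plots_over X)"
  shows "snd P \<in> snd (ext_obj (fst P)) \<rightarrow>\<^sub>E points X"
  using concrete_sheafD(1)[OF assms(1) ext_obj_fermat] assms(2) by (simp add: Ob_plots_over)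

lemma push_plot_ident:
  assumes "is_fermat_space X" "P \<in> Ob (plots_over X)"
  shows "push_plot (\<lambda>x\<in>points X. x) P = P"
proof -
  have "compose (snd (ext_obj (fst P))) (\<lambda>x\<in>points X. x) (snd P) = snd P"
    using plot_in[OF assms] by (auto simp: compose_def PiE_iff extensional_def fun_eq_iff)
  then show ?thesis by (simp add: prod_eq_iff)
qed

lemma push_plot_compose:
  assumes "is_fermat_space X" "P \<in> Ob (plots_over X)"
  shows "push_plot (compose (points X) h g) P = push_plot h (push_plot g P)"
proof -
  have "snd P \<in> snd (ext_obj (fst P)) \<rightarrow> points X"
    using plot_in[OF assms] by (simp add: PiE_def)
  from compose_assoc[OF this, of h g] show ?thesis
    by (simp add: prod_eq_iff)
qed

lemma push_plot_cocone:
  assumes g: "g \<in> fermat_maps X Y"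
  shows "is_cocone (plots_over X) base_space base_map (del Y) (\<lambda>P. del_leg Y (push_plot g P))"
  unfolding is_cocone_def
proof (intro conjI ballI)
  fix P assume "P \<in> Ob (plots_over X)"
  then have "push_plot g P \<in> Ob (plots_over Y)" by (rule push_plot_Ob[OF g])
  then have "del_leg Y (push_plot g P) \<in> smooth_maps (base_space (push_plot g P)) (del Y)"
    using del_is_cocone[of Y] by (simp only: is_cocone_def)
  then show "del_leg Y (push_plot g P) \<in> smooth_maps (base_space P) (del Y)"
    by simp
next
  fix P Q f assume PQ: "P \<in> Ob (plots_over X)" "Q \<in> Ob (plots_over X)" "f \<in> Hom (plots_over X) P Q"
  have "compose (points (base_space (push_plot g P))) (del_leg Y (push_plot g Q))
      (base_map (push_plot g P) (push_plot g Q) f) = del_leg Y (push_plot g P)"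
    using del_is_cocone[of Y] push_plot_Ob[OF g PQ(1)] push_plot_Ob[OF g PQ(2)] push_plot_Hom[OF PQ(3)]
    unfolding is_cocone_def by blast
  then show "compose (points (base_space P)) (del_leg Y (push_plot g Q)) (base_map P Q f) =
      del_leg Y (push_plot g P)"
    by simp
qed

lemma del_map_mediating:
  assumes "g \<in> fermat_maps X Y"
  shows "del_map X Y g \<in> mediating_maps (plots_over X) base_space base_map (del X) (del_leg X)
    (del Y) (\<lambda>P. del_leg Y (push_plot g P))"
  unfolding del_map_def
  using colim_desc_mediating[OF base_functor del_is_diff_space push_plot_cocone[OF assms]]
  by (simp only: del_def del_leg_def)

text \<open>
  The form of uniqueness by which both functor laws are proved.
\<close>
lemma del_map_eqI:
  assumes "u \<in> smooth_maps (del X) (del Y)"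
    and "\<And>P. P \<in> Ob (plots_over X) \<Longrightarrow>
      compose (points (base_space P)) u (del_leg X P) = del_leg Y (push_plot g P)"
  shows "del_map X Y g = u"
  unfolding del_map_def
proof (rule colim_desc_eqI)
  show "u \<in> mediating_maps (plots_over X) base_space base_map
      (colim (plots_over X) base_space base_map) (colim_leg (plots_over X) base_space base_map)
      (del Y) (\<lambda>P. del_leg Y (push_plot g P))"
    using assms by (simp add: mediating_maps_def flip: del_def del_leg_def)
qed

lemma del_map_smooth: "g \<in> fermat_maps X Y \<Longrightarrow> del_map X Y g \<in> smooth_maps (del X) (del Y)"
  using del_map_mediating[of g X Y] by (simp add: mediating_maps_def)

lemma del_map_leg:
  "g \<in> fermat_maps X Y \<Longrightarrow> P \<in> Ob (plots_over X) \<Longrightarrow>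
     compose (points (base_space P)) (del_map X Y g) (del_leg X P) = del_leg Y (push_plot g P)"
  using del_map_mediating[of g X Y] unfolding mediating_maps_def by blast

lemma del_leg_in:
  "P \<in> Ob (plots_over X) \<Longrightarrow> del_leg X P \<in> points (base_space P) \<rightarrow>\<^sub>E points (del X)"
  unfolding del_def del_leg_def by (rule colim_leg_in)

lemma del_map_ident:
  assumes "is_fermat_space X"
  shows "del_map X X (\<lambda>x\<in>points X. x) = (\<lambda>c\<in>points (del X). c)"
proof (rule del_map_eqI)
  show "(\<lambda>c\<in>points (del X). c) \<in> smooth_maps (del X) (del X)"
    by (rule sheaf_maps_ident[OF del_is_diff_space])
  fix P assume P: "P \<in> Ob (plots_over X)"
  show "compose (points (base_space P)) (\<lambda>c\<in>points (del X). c) (del_leg X P) =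
      del_leg X (push_plot (\<lambda>x\<in>points X. x) P)"
    using del_leg_in[OF P]
    by (auto simp: push_plot_ident[OF assms P] compose_def PiE_iff extensional_def fun_eq_iff)
qed

lemma del_map_compose:
  assumes X: "is_fermat_space X" and g: "g \<in> fermat_maps X Y" and h: "h \<in> fermat_maps Y Z"
  shows "del_map X Z (compose (points X) h g) =
    compose (points (del X)) (del_map Y Z h) (del_map X Y g)"
proof (rule del_map_eqI)
  show "compose (points (del X)) (del_map Y Z h) (del_map X Y g) \<in> smooth_maps (del X) (del Z)"
    by (rule sheaf_maps_compose[OF del_is_diff_space del_map_smooth[OF g] del_map_smooth[OF h]])
  fix P assume P: "P \<in> Ob (plots_over X)"
  let ?B = "points (base_space P)"
  have "del_leg X P \<in> ?B \<rightarrow> points (del X)"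
    using del_leg_in[OF P] by auto
  then have "compose ?B (compose (points (del X)) (del_map Y Z h) (del_map X Y g)) (del_leg X P) =
      compose ?B (del_map Y Z h) (compose ?B (del_map X Y g) (del_leg X P))"
    by (rule compose_assoc[symmetric])
  also have "\<dots> = compose ?B (del_map Y Z h) (del_leg Y (push_plot g P))"
    by (simp only: del_map_leg[OF g P])
  also have "\<dots> = del_leg Z (push_plot h (push_plot g P))"
    using del_map_leg[OF h push_plot_Ob[OF g P]] by simp
  also have "\<dots> = del_leg Z (push_plot (compose (points X) h g) P)"
    by (simp only: push_plot_compose[OF X P])
  finally show "compose ?B (compose (points (del X)) (del_map Y Z h) (del_map X Y g)) (del_leg X P) =
      del_leg Z (push_plot (compose (points X) h g) P)" .
qed

theorem proposition16:
  fixes X :: "'a fermat_space" and Y :: "'b fermat_space" and Z :: "'c fermat_space"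
  assumes "is_fermat_space X" and "is_fermat_space Y" and "is_fermat_space Z"
  shows
    "is_functor (plots_over X) diff_cat base_space base_map
     \<and> is_diff_space (del X)
     \<and> is_cocone (plots_over X) base_space base_map (del X) (del_leg X)
     \<and> (\<forall>(T :: 'd diff_space) h.
          is_diff_space T \<and> is_cocone (plots_over X) base_space base_map T h \<longrightarrow>
          (\<exists>!u. u \<in> mediating_maps (plots_over X) base_space base_map (del X) (del_leg X) T h))
     \<and> (\<forall>g\<in>fermat_maps X Y.
          del_map X Y g \<in> smooth_maps (del X) (del Y) \<and>
          (\<forall>P\<in>Ob (plots_over X).
             compose (points (base_space P)) (del_map X Y g) (del_leg X P) =
             del_leg Y (push_plot g P)))
     \<and> del_map X X (\<lambda>x\<in>points X. x) = (\<lambda>c\<in>points (del X). c)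
     \<and> (\<forall>g\<in>fermat_maps X Y. \<forall>h\<in>fermat_maps Y Z.
          del_map X Z (compose (points X) h g) =
          compose (points (del X)) (del_map Y Z h) (del_map X Y g))"
proof (intro conjI allI impI ballI)
  fix T :: "'d diff_space" and h
  assume "is_diff_space T \<and> is_cocone (plots_over X) base_space base_map T h"
  then show "\<exists>!u. u \<in> mediating_maps (plots_over X) base_space base_map (del X) (del_leg X) T h"
    unfolding del_def del_leg_def by (intro colim_universal[OF base_functor]) auto
qed (simp_all only: base_functor del_is_diff_space del_is_cocone del_map_smooth del_map_leg
    del_map_ident[OF assms(1)] del_map_compose[OF assms(1)])

end
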